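(* Consider problem (MR3) and the iterations [S1a$'$], [S1b$'$], [S2$'$] defined in the context. Suppose that the dual variables are initialized at $\boldsymbol{\gamma}^{(\ell)}_{\mathcal{I}(\ell,j)}(0)=\boldsymbol{\gamma}^{(j)}_{\mathcal{I}(\ell,j)}(0)=\boldsymbol{\mu}_{\mathcal{I}(\ell,j)}(0)=\mathbf{0}$ for all pairs of neighboring areas $\ell,j$. Then, for any $\kappa>0$, the iterates $\{\boldsymbol{\xi}^{(\ell)}(i),\mathbf{s}_G^{(\ell)}(i),\boldsymbol{\chi}_{\mathcal{I}(\ell,j)}(i),\mathbf{d}(i)\}$, where $\mathbf{d}(i)$ collects all $\boldsymbol{\gamma}^{(\ell)}_{\mathcal{I}(\ell,j)}(i)$ and $\boldsymbol{\mu}_{\mathcal{I}(\ell,j)}(i)$, are convergent, and $$\lim_{i\to+\infty}\{\boldsymbol{\xi}^{(\ell)}(i),\mathbf{s}_G^{(\ell)}(i),\ \ell=1,\dots,L\}=\{\boldsymbol{\xi}_{\mathrm{opt}},\boldsymbol{\sigma}^\phi_{G_n,\mathrm{opt}}\},$$ where $\{\boldsymbol{\xi}_{\mathrm{opt}},\boldsymbol{\sigma}^\phi_{G_n,\mathrm{opt}}\}$ is the optimal solution of (MR3); that is, for each $\ell$, the limits of $\boldsymbol{\xi}^{(\ell)}(i)$ and $\mathbf{s}_G^{(\ell)}(i)$ are the subvectors of the optimal solution corresponding to the lines and DG units of area $\ell$.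
   Context: **Network.** $(\mathcal{N},\mathcal{E})$ is a directed graph with nodes $\mathcal{N}=\{1,\dots,N\}$ and lines $\mathcal{E}\subset\mathcal{N}\times\mathcal{N}$; $\mathcal{P}_{mn},\mathcal{P}_n\subseteq\{a,b,c\}$ are the nonempty phase sets of line $(m,n)$ and node $n$; $\mathcal{E}_R\subset\mathcal{E}$ is the set of lines equipped with switches. $\boldsymbol{\xi}_{mn}\in\mathbb{R}^{2|\mathcal{P}_{mn}|}$ stacks the real parts and then the imaginary parts of the line currents $I_{mn}^\phi\in\mathbb{C}$, $\phi\in\mathcal{P}_{mn}$; $\boldsymbol{\xi}$ stacks all $\boldsymbol{\xi}_{mn}$. For each node $n$ and phase $\phi\in\mathcal{P}_n$, $\boldsymbol{A}_n^\phi$ is the $2$-row matrix such that $\boldsymbol{A}_n^\phi\boldsymbol{\xi}$ consists of the real and imaginary parts of $$I_n^\phi=\sum_{k:(n,k)\in\mathcal{E},\,\phi\in\mathcal{P}_n\cap\mathcal{P}_{nk}}I_{nk}^\phi-\sum_{j:(j,n)\in\mathcal{E},\,\phi\in\mathcal{P}_n\cap\mathcal{P}_{jn}}I_{jn}^\phi .$$ $\bar{\boldsymbol{M}}_{mn}^\phi=\mathbf{I}_2\otimes\mathbf{e}_{mn}^\phi(\mathbf{e}_{mn}^\phi)^{T}$, with $\{\mathbf{e}_{mn}^\phi\}_{\phi\in\mathcal{P}_{mn}}$ the canonical basis of $\mathbb{R}^{|\mathcal{P}_{mn}|}$, so that $\boldsymbol{\xi}_{mn}^{T}\bar{\boldsymbol{M}}_{mn}^\phi\boldsymbol{\xi}_{mn}=|I_{mn}^\phi|^2$;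 $I_{mn}^{\max}$ is a given cap. $\mathcal{D}$ is the set of phase-node pairs $(\phi,n)$ with a renewable source and/or a load, and $\bar{\mathcal{D}}$ the set of the remaining pairs. $\boldsymbol{\sigma}_{G_n}^\phi=(P_{G_n}^\phi,Q_{G_n}^\phi)\in\mathbb{R}^2$ is the active and reactive power supplied by conventional distributed generation (DG) at phase $\phi$ of node $n$ (zero where there is no DG unit), with given box constraints $S_n^{\min}\preceq\boldsymbol{\sigma}_{G_n}^\phi\preceq S_n^{\max}$ for DG units. For $(\phi,n)\in\mathcal{D}$, $P_n^\phi(k),Q_n^\phi(k)$, $k=1,\dots,K$, are given real numbers (samples of the net uncertain supply). With nominal voltage $M_Ne^{j\varphi_N^\phi}$ on phase $\phi$, $\boldsymbol{\varphi}_n^\phi=M_N[\Re\{e^{j\varphi_N^\phi}\},\Im\{e^{j\varphi_N^\phi}\}]^{T}$ and $\bar{\boldsymbol{\varphi}}_n^\phi=M_N[\Im\{e^{j\varphi_N^\phi}\},-\Re\{e^{j\varphi_N^\phi}\}]^{T}$. **Areas.** $\mathcal{N}$ is partitioned into $L$ areas $\mathcal{A}^{(1)},\dots,\mathcal{A}^{(L)}$. Areas $\ell\ne j$ are neighbors, $j\in\mathcal{N}^{(\ell)}$, if some line joins them; $\mathcal{I}(\ell,j)=\mathcal{I}(j,\ell)$ denotes the line(s) joining areas $\ell$ and $j$ (empty if they are not neighbors), and all these lines are equipped with switches. $\mathcal{E}^{(\ell)}$ is the set of lines with both endpoints in $\mathcal{A}^{(\ell)}$ together with the lines joining $\mathcal{A}^{(\ell)}$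 to neighboring areas; $\mathcal{E}_R^{(\ell)}=\{(m,n)\in\mathcal{E}_R:m,n\in\mathcal{A}^{(\ell)}\}$. $\boldsymbol{\xi}^{(\ell)}$ is area $\ell$'s vector of real and imaginary parts of currents on lines in $\mathcal{E}^{(\ell)}$, with subvectors $\boldsymbol{\xi}^{(\ell)}_{mn}$ and $\boldsymbol{\xi}^{(\ell)}_{\mathcal{I}(\ell,j)}$; $\mathbf{s}_G^{(\ell)}$ collects the DG powers $\boldsymbol{\sigma}_{G_n}^\phi$ at nodes of $\mathcal{A}^{(\ell)}$; $\boldsymbol{\chi}_{\mathcal{I}(\ell,j)}$ is a copy of the vector of currents on $\mathcal{I}(\ell,j)$. The matrices $\bar{\boldsymbol{M}}^\phi_{\mathcal{I}(\ell,j)}$ and bounds $I^{\max}_{\mathcal{I}(\ell,j)}$ are those of the corresponding line(s); thus the constraint $\boldsymbol{\chi}^{T}_{\mathcal{I}(\ell,j)}\bar{\boldsymbol{M}}^\phi_{\mathcal{I}(\ell,j)}\boldsymbol{\chi}_{\mathcal{I}(\ell,j)}\le(I^{\max}_{\mathcal{I}(\ell,j)})^2$ means that each line current in phase $\phi$ has magnitude at most its cap. **Problem (MR3).** Minimize over $\boldsymbol{\xi},\{\boldsymbol{\sigma}_{G_n}^\phi\}$ the objective $$\sum_{\ell=1}^L\Big[C^{(\ell)}(\boldsymbol{\xi}^{(\ell)},\mathbf{s}_G^{(\ell)})+\sum_{(m,n)\in\mathcal{E}_R^{(\ell)}}\lambda^{(\ell)}\|\boldsymbol{\xi}_{mn}\|_2\Big]+\sum_{\ell=1}^L\sum_{j>\ell,\,j\in\mathcal{N}^{(\ell)}}\Big[C_{\mathcal{I}(\ell,j)}(\boldsymbol{\xi}_{\mathcal{I}(\ell,j)})+\lambda_{\mathcal{I}(\ell,j)}\|\boldsymbol{\xi}_{\mathcal{I}(\ell,j)}\|_2\Big]$$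 (here $\boldsymbol{\xi}^{(\ell)}$, $\boldsymbol{\xi}_{\mathcal{I}(\ell,j)}$ are subvectors of $\boldsymbol{\xi}$), where the functions $C^{(\ell)}$ and $C_{\mathcal{I}(\ell,j)}$ are convex and the weights $\lambda^{(\ell)},\lambda_{\mathcal{I}(\ell,j)}$ are positive, subject to the DG box constraints and - $(\boldsymbol{\varphi}_n^\phi)^{T}\boldsymbol{A}_n^\phi\boldsymbol{\xi}\le P_{G_n}^\phi+\min_kP_n^\phi(k)$ and $(\bar{\boldsymbol{\varphi}}_n^\phi)^{T}\boldsymbol{A}_n^\phi\boldsymbol{\xi}\le Q_{G_n}^\phi+\min_kQ_n^\phi(k)$ for $(\phi,n)\in\mathcal{D}$; - $\boldsymbol{\xi}_{mn}^{T}\bar{\boldsymbol{M}}_{mn}^\phi\boldsymbol{\xi}_{mn}\le(I_{mn}^{\max})^2$ for $\phi\in\mathcal{P}_{mn}$, $(m,n)\in\mathcal{E}$; - $\boldsymbol{A}_n^\phi\boldsymbol{\xi}=\mathbf{0}$ for $(\phi,n)\in\bar{\mathcal{D}}$. $\mathcal{F}^{(\ell)}$ denotes the set of $(\boldsymbol{\xi}^{(\ell)},\mathbf{s}_G^{(\ell)})$ satisfying those of these constraints that pertain to nodes of $\mathcal{A}^{(\ell)}$, to their DG units and to lines in $\mathcal{E}^{(\ell)}$ (the constraints at a node $n\in\mathcal{A}^{(\ell)}$ involve only lines in $\mathcal{E}^{(\ell)}$). **Iterations**, with parameter $\kappa>0$ and for $i=0,1,2,\dots$: [S1a$'$] For each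 area $\ell$, $\{\boldsymbol{\xi}^{(\ell)}(i+1),\mathbf{s}_G^{(\ell)}(i+1)\}$ is a minimizer over $(\boldsymbol{\xi}^{(\ell)},\mathbf{s}_G^{(\ell)})\in\mathcal{F}^{(\ell)}$ of $$C^{(\ell)}(\boldsymbol{\xi}^{(\ell)},\mathbf{s}_G^{(\ell)})+\sum_{(m,n)\in\mathcal{E}_R^{(\ell)}}\lambda^{(\ell)}\|\boldsymbol{\xi}^{(\ell)}_{mn}\|_2+\sum_{j\in\mathcal{N}^{(\ell)}}\Big[\boldsymbol{\gamma}^{(\ell)}_{\mathcal{I}(\ell,j)}(i)^{T}\boldsymbol{\xi}^{(\ell)}_{\mathcal{I}(\ell,j)}+\tfrac{\kappa}{2}\|\boldsymbol{\xi}^{(\ell)}_{\mathcal{I}(\ell,j)}\|_2^2-\tfrac{\kappa}{3}(\boldsymbol{\xi}^{(\ell)}_{\mathcal{I}(\ell,j)})^{T}\big(\boldsymbol{\xi}^{(\ell)}_{\mathcal{I}(\ell,j)}(i)+\boldsymbol{\xi}^{(j)}_{\mathcal{I}(\ell,j)}(i)+\boldsymbol{\chi}_{\mathcal{I}(\ell,j)}(i)\big)\Big].$$ [S1b$'$] For each $\mathcal{I}(\ell,j)$, $\boldsymbol{\chi}_{\mathcal{I}(\ell,j)}(i+1)$ is the minimizer over $\boldsymbol{\chi}$, subject to $\boldsymbol{\chi}^{T}\bar{\boldsymbol{M}}^\phi_{\mathcal{I}(\ell,j)}\boldsymbol{\chi}\le(I^{\max}_{\mathcal{I}(\ell,j)})^2$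 for all $\phi$, of $$C_{\mathcal{I}(\ell,j)}(\boldsymbol{\chi})+\lambda_{\mathcal{I}(\ell,j)}\|\boldsymbol{\chi}\|_2+\tfrac{\kappa}{2}\|\boldsymbol{\chi}\|_2^2-\boldsymbol{\chi}^{T}\Big[\boldsymbol{\mu}_{\mathcal{I}(\ell,j)}(i)+\tfrac{\kappa}{3}\big(\boldsymbol{\xi}^{(\ell)}_{\mathcal{I}(\ell,j)}(i)+\boldsymbol{\xi}^{(j)}_{\mathcal{I}(\ell,j)}(i)+\boldsymbol{\chi}_{\mathcal{I}(\ell,j)}(i)\big)\Big].$$ [S2$'$] For each area $\ell$ and each $j\in\mathcal{N}^{(\ell)}$, $$\boldsymbol{\gamma}^{(\ell)}_{\mathcal{I}(\ell,j)}(i+1)=\boldsymbol{\gamma}^{(\ell)}_{\mathcal{I}(\ell,j)}(i)+\tfrac{\kappa}{3}\big(2\boldsymbol{\xi}^{(\ell)}_{\mathcal{I}(\ell,j)}(i+1)-\boldsymbol{\xi}^{(j)}_{\mathcal{I}(\ell,j)}(i+1)-\boldsymbol{\chi}_{\mathcal{I}(\ell,j)}(i+1)\big),$$ and for each $\mathcal{I}(\ell,j)$, $$\boldsymbol{\mu}_{\mathcal{I}(\ell,j)}(i+1)=\boldsymbol{\mu}_{\mathcal{I}(\ell,j)}(i)+\tfrac{\kappa}{3}\big(\boldsymbol{\xi}^{(\ell)}_{\mathcal{I}(\ell,j)}(i+1)+\boldsymbol{\xi}^{(j)}_{\mathcal{I}(\ell,j)}(i+1)-2\boldsymbol{\ch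i}_{\mathcal{I}(\ell,j)}(i+1)\big).$$
   Formalization: Adds a Slater condition: some feasible point of (MR3) satisfies all current-magnitude caps strictly; without it the dual iterates d(i) can fail to converge. The optimal solution of (MR3) is assumed to exist and be unique. *)

theory Defs
  imports "HOL-Analysis.Analysis"
begin

datatype phase = PhA | PhB | PhC

instance phase :: finite
proof
  have "(UNIV :: phase set) \<subseteq> {PhA, PhB, PhC}"
    using phase.exhaust by auto
  then show "finite (UNIV :: phase set)"
    by (rule finite_subset) simp
qed

text \<open>
  A vector \<open>stacked\<close> holds the currents of one line: the index \<open>(1, \<phi>)\<close> carries the real part and
  \<open>(2, \<phi>)\<close> the imaginary part of the current on phase \<open>\<phi>\<close>. Vectors over a subset of the lines (or
  over the phases actually present, or over the nodes of one area) are represented as vectors of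
  the full space that vanish at all other coordinates; the spaces \<open>current_space\<close> and \<open>dg_space\<close>
  below are thus isometric copies of the coordinate spaces of the right dimension, and taking a
  subvector amounts to setting the remaining coordinates to zero.
\<close>

type_synonym stacked = "real ^ (2 \<times> phase)"
type_synonym 'n currents = "stacked ^ ('n \<times> 'n)"
type_synonym 'n dg_powers = "((real ^ 2) ^ phase) ^ 'n"

text \<open>
  The nodes are the elements of the finite type \<open>'n\<close>. Area \<open>l\<close> ranges over \<open>{1..num_areas g}\<close>.
  Quantities attached to the tie lines joining two areas (\<open>tie_cost\<close>, \<open>tie_weight\<close>) are indexed by
  the set of these lines, hence by the unordered pair of areas. The pairs in \<open>uncertain\<close> are those
  with a renewable source or a load; \<open>P_sample\<close> and \<open>Q_sample\<close> give their net supply.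
\<close>

record ('n :: finite) microgrid =
  lines :: "('n \<times> 'n) set"
  switched :: "('n \<times> 'n) set"
  line_phases :: "'n \<times> 'n \<Rightarrow> phase set"
  node_phases :: "'n \<Rightarrow> phase set"
  current_cap :: "'n \<times> 'n \<Rightarrow> real"
  uncertain :: "(phase \<times> 'n) set"
  dg_units :: "(phase \<times> 'n) set"
  dg_min :: "'n \<Rightarrow> real ^ 2"
  dg_max :: "'n \<Rightarrow> real ^ 2"
  num_samples :: nat
  P_sample :: "phase \<Rightarrow> 'n \<Rightarrow> nat \<Rightarrow> real"
  Q_sample :: "phase \<Rightarrow> 'n \<Rightarrow> nat \<Rightarrow> real"
  nominal_magnitude :: real
  nominal_angle :: "phase \<Rightarrow> real"
  num_areas :: nat
  area :: "nat \<Rightarrow> 'n set"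
  area_cost :: "nat \<Rightarrow> 'n currents \<times> 'n dg_powers \<Rightarrow> real"
  tie_cost :: "('n \<times> 'n) set \<Rightarrow> 'n currents \<Rightarrow> real"
  area_weight :: "nat \<Rightarrow> real"
  tie_weight :: "('n \<times> 'n) set \<Rightarrow> real"

definition node_pairs :: "('n :: finite) microgrid \<Rightarrow> (phase \<times> 'n) set" where
  "node_pairs g = {(\<phi>, n). \<phi> \<in> node_phases g n}"

definition tie :: "('n :: finite) microgrid \<Rightarrow> nat \<Rightarrow> nat \<Rightarrow> ('n \<times> 'n) set" where
  "tie g l j = lines g \<inter> (area g l \<times> area g j \<union> area g j \<times> area g l)"

definition neighbors :: "('n :: finite) microgrid \<Rightarrow> nat \<Rightarrow> nat set" where
  "neighbors g l = {j \<in> {1..num_areas g}. j \<noteq> l \<and> tie g l j \<noteq> {}}"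

definition area_lines :: "('n :: finite) microgrid \<Rightarrow> nat \<Rightarrow> ('n \<times> 'n) set" where
  "area_lines g l = (lines g \<inter> area g l \<times> area g l) \<union> (\<Union>j\<in>neighbors g l. tie g l j)"

definition area_switched :: "('n :: finite) microgrid \<Rightarrow> nat \<Rightarrow> ('n \<times> 'n) set" where
  "area_switched g l = switched g \<inter> area g l \<times> area g l"

definition current_space :: "('n :: finite) microgrid \<Rightarrow> ('n \<times> 'n) set \<Rightarrow> 'n currents set" where
  "current_space g B = {\<xi>. \<forall>e p \<phi>. \<not> (e \<in> B \<and> \<phi> \<in> line_phases g e) \<longrightarrow> \<xi> $ e $ (p, \<phi>) = 0}"

definition on_lines :: "('n :: finite \<times> 'n) set \<Rightarrow> 'n currents \<Rightarrow> 'n currents" where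
  "on_lines B \<xi> = (\<chi> e. if e \<in> B then \<xi> $ e else 0)"

definition dg_space :: "('n :: finite) microgrid \<Rightarrow> 'n set \<Rightarrow> 'n dg_powers set" where
  "dg_space g V = {\<sigma>. \<forall>n \<phi>. \<not> (n \<in> V \<and> (\<phi>, n) \<in> dg_units g) \<longrightarrow> \<sigma> $ n $ \<phi> = 0}"

definition on_nodes :: "('n :: finite) set \<Rightarrow> 'n dg_powers \<Rightarrow> 'n dg_powers" where
  "on_nodes V \<sigma> = (\<chi> n. if n \<in> V then \<sigma> $ n else 0)"

definition line_current :: "('n :: finite) currents \<Rightarrow> 'n \<times> 'n \<Rightarrow> phase \<Rightarrow> complex" where
  "line_current \<xi> e \<phi> = Complex (\<xi> $ e $ (1, \<phi>)) (\<xi> $ e $ (2, \<phi>))"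

definition node_current :: "('n :: finite) microgrid \<Rightarrow> 'n currents \<Rightarrow> 'n \<Rightarrow> phase \<Rightarrow> complex" where
  "node_current g \<xi> n \<phi> =
     (\<Sum>k | (n, k) \<in> lines g \<and> \<phi> \<in> node_phases g n \<inter> line_phases g (n, k). line_current \<xi> (n, k) \<phi>)
   - (\<Sum>j | (j, n) \<in> lines g \<and> \<phi> \<in> node_phases g n \<inter> line_phases g (j, n). line_current \<xi> (j, n) \<phi>)"

text \<open>\<open>A_map g n \<phi> \<xi>\<close> is the product of the two-row matrix of node \<open>n\<close> and phase \<open>\<phi>\<close> with \<open>\<xi>\<close>.\<close>

definition A_map :: "('n :: finite) microgrid \<Rightarrow> 'n \<Rightarrow> phase \<Rightarrow> 'n currents \<Rightarrow> real ^ 2" where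
  "A_map g n \<phi> \<xi> = vector [Re (node_current g \<xi> n \<phi>), Im (node_current g \<xi> n \<phi>)]"

definition volt :: "('n :: finite) microgrid \<Rightarrow> phase \<Rightarrow> real ^ 2" where
  "volt g \<phi> = nominal_magnitude g *\<^sub>R
     vector [Re (exp (\<i> * nominal_angle g \<phi>)), Im (exp (\<i> * nominal_angle g \<phi>))]"

definition volt_bar :: "('n :: finite) microgrid \<Rightarrow> phase \<Rightarrow> real ^ 2" where
  "volt_bar g \<phi> = nominal_magnitude g *\<^sub>R
     vector [Im (exp (\<i> * nominal_angle g \<phi>)), - Re (exp (\<i> * nominal_angle g \<phi>))]"

text \<open>The Kronecker product of the identity of size 2 with the projection on the phase \<open>\<phi>\<close>.\<close>

definition M_bar :: "phase \<Rightarrow> real ^ (2 \<times> phase) ^ (2 \<times> phase)" where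
  "M_bar \<phi> = (\<chi> r c. (mat 1 :: real ^ 2 ^ 2) $ fst r $ fst c
                     * ((axis \<phi> 1 :: real ^ phase) $ snd r * (axis \<phi> 1 :: real ^ phase) $ snd c))"

lemma M_bar_quadratic_form:
  "(\<xi> $ e) \<bullet> (M_bar \<phi> *v (\<xi> $ e)) = (cmod (line_current \<xi> e \<phi>))\<^sup>2"
proof -
  have UNIV_phase: "(UNIV :: phase set) = {PhA, PhB, PhC}"
    using phase.exhaust by auto
  show ?thesis
    unfolding inner_vec_def matrix_vector_mult_def M_bar_def line_current_def
    by (cases \<phi>)
       (simp_all add: UNIV_Times_UNIV[symmetric] sum.cartesian_product[symmetric] UNIV_2 UNIV_phase
          mat_def axis_def cmod_power2 del: UNIV_Times_UNIV flip: power2_eq_square)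
qed

definition P_min :: "('n :: finite) microgrid \<Rightarrow> phase \<Rightarrow> 'n \<Rightarrow> real" where
  "P_min g \<phi> n = Min (P_sample g \<phi> n ` {1..num_samples g})"

definition Q_min :: "('n :: finite) microgrid \<Rightarrow> phase \<Rightarrow> 'n \<Rightarrow> real" where
  "Q_min g \<phi> n = Min (Q_sample g \<phi> n ` {1..num_samples g})"

definition within_caps :: "('n :: finite) microgrid \<Rightarrow> ('n \<times> 'n) set \<Rightarrow> 'n currents \<Rightarrow> bool" where
  "within_caps g B \<xi> \<longleftrightarrow>
     (\<forall>e\<in>B. \<forall>\<phi>\<in>line_phases g e. (\<xi> $ e) \<bullet> (M_bar \<phi> *v (\<xi> $ e)) \<le> (current_cap g e)\<^sup>2)"

definition strictly_within_caps ::
    "('n :: finite) microgrid \<Rightarrow> ('n \<times> 'n) set \<Rightarrow> 'n currents \<Rightarrow> bool" where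
  "strictly_within_caps g B \<xi> \<longleftrightarrow>
     (\<forall>e\<in>B. \<forall>\<phi>\<in>line_phases g e. (\<xi> $ e) \<bullet> (M_bar \<phi> *v (\<xi> $ e)) < (current_cap g e)\<^sup>2)"

definition dg_boxes :: "('n :: finite) microgrid \<Rightarrow> 'n set \<Rightarrow> 'n dg_powers \<Rightarrow> bool" where
  "dg_boxes g V \<sigma> \<longleftrightarrow>
     (\<forall>n\<in>V. \<forall>\<phi>. (\<phi>, n) \<in> dg_units g \<longrightarrow> dg_min g n \<le> \<sigma> $ n $ \<phi> \<and> \<sigma> $ n $ \<phi> \<le> dg_max g n)"

definition node_balances ::
    "('n :: finite) microgrid \<Rightarrow> 'n set \<Rightarrow> 'n currents \<Rightarrow> 'n dg_powers \<Rightarrow> bool" where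
  "node_balances g V \<xi> \<sigma> \<longleftrightarrow>
     (\<forall>n\<in>V. \<forall>\<phi>.
        ((\<phi>, n) \<in> uncertain g \<longrightarrow>
           volt g \<phi> \<bullet> A_map g n \<phi> \<xi> \<le> \<sigma> $ n $ \<phi> $ 1 + P_min g \<phi> n \<and>
           volt_bar g \<phi> \<bullet> A_map g n \<phi> \<xi> \<le> \<sigma> $ n $ \<phi> $ 2 + Q_min g \<phi> n) \<and>
        ((\<phi>, n) \<in> node_pairs g - uncertain g \<longrightarrow> A_map g n \<phi> \<xi> = 0))"

text \<open>The constraints that pertain to the nodes in \<open>V\<close>, to their DG units and to the lines in \<open>B\<close>.\<close>

definition feasible_on ::
    "('n :: finite) microgrid \<Rightarrow> 'n set \<Rightarrow> ('n \<times> 'n) set \<Rightarrow> ('n currents \<times> 'n dg_powers) set" where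
  "feasible_on g V B = {(\<xi>, \<sigma>). \<xi> \<in> current_space g B \<and> \<sigma> \<in> dg_space g V \<and>
     dg_boxes g V \<sigma> \<and> node_balances g V \<xi> \<sigma> \<and> within_caps g B \<xi>}"

definition mr3_feasible :: "('n :: finite) microgrid \<Rightarrow> ('n currents \<times> 'n dg_powers) set" where
  "mr3_feasible g = feasible_on g UNIV (lines g)"

definition area_feasible ::
    "('n :: finite) microgrid \<Rightarrow> nat \<Rightarrow> ('n currents \<times> 'n dg_powers) set" where
  "area_feasible g l = feasible_on g (area g l) (area_lines g l)"

definition well_formed :: "('n :: finite) microgrid \<Rightarrow> bool" where
  "well_formed g \<longleftrightarrow>
     switched g \<subseteq> lines g \<and>
     (\<forall>e\<in>lines g. line_phases g e \<noteq> {}) \<and>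
     (\<forall>n. node_phases g n \<noteq> {}) \<and>
     uncertain g \<subseteq> node_pairs g \<and>
     dg_units g \<subseteq> node_pairs g \<and>
     1 \<le> num_samples g \<and>
     (\<Union>l\<in>{1..num_areas g}. area g l) = UNIV \<and>
     disjoint_family_on (area g) {1..num_areas g} \<and>
     (\<forall>l\<in>{1..num_areas g}. area g l \<noteq> {}) \<and>
     (\<forall>l\<in>{1..num_areas g}. \<forall>j\<in>neighbors g l. tie g l j \<subseteq> switched g)"

definition convex_costs :: "('n :: finite) microgrid \<Rightarrow> bool" where
  "convex_costs g \<longleftrightarrow>
     (\<forall>l\<in>{1..num_areas g}.
        convex_on (current_space g (area_lines g l) \<times> dg_space g (area g l)) (area_cost g l) \<and>
        0 < area_weight g l \<and>
        (\<forall>j\<in>neighbors g l.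
           convex_on (current_space g (tie g l j)) (tie_cost g (tie g l j)) \<and>
           0 < tie_weight g (tie g l j)))"

definition mr3_objective :: "('n :: finite) microgrid \<Rightarrow> 'n currents \<times> 'n dg_powers \<Rightarrow> real" where
  "mr3_objective g = (\<lambda>(\<xi>, \<sigma>).
     (\<Sum>l = 1..num_areas g.
        area_cost g l (on_lines (area_lines g l) \<xi>, on_nodes (area g l) \<sigma>)
        + (\<Sum>e\<in>area_switched g l. area_weight g l * norm (\<xi> $ e)))
   + (\<Sum>l = 1..num_areas g. \<Sum>j | j \<in> neighbors g l \<and> j > l.
        tie_cost g (tie g l j) (on_lines (tie g l j) \<xi>)
        + tie_weight g (tie g l j) * norm (on_lines (tie g l j) \<xi>)))"

definition mr3_optimal :: "('n :: finite) microgrid \<Rightarrow> 'n currents \<times> 'n dg_powers \<Rightarrow> bool" where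
  "mr3_optimal g = is_arg_min (mr3_objective g) (\<lambda>p. p \<in> mr3_feasible g)"

text \<open>
  Slater's condition in its usual form: only the constraints that are not affine, that is the caps
  on the magnitudes of the currents, have to hold strictly.
\<close>

definition mr3_slater :: "('n :: finite) microgrid \<Rightarrow> bool" where
  "mr3_slater g \<longleftrightarrow> (\<exists>(\<xi>, \<sigma>)\<in>mr3_feasible g. strictly_within_caps g (lines g) \<xi>)"

text \<open>
  Arguments of the following definitions: \<open>x i l\<close> and \<open>s i l\<close> are the currents and DG powers computed
  by area \<open>l\<close>, \<open>chi i (tie g l j)\<close> is the copy of the currents on the lines joining areas \<open>l\<close> and \<open>j\<close>,
  \<open>gam i l j\<close> is the multiplier kept by area \<open>l\<close> for these lines and \<open>mu i (tie g l j)\<close> the one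
  of the copy.
\<close>

definition tie_sum :: "('n :: finite) microgrid \<Rightarrow> (nat \<Rightarrow> 'n currents) \<Rightarrow>
    (('n \<times> 'n) set \<Rightarrow> 'n currents) \<Rightarrow> nat \<Rightarrow> nat \<Rightarrow> 'n currents" where
  "tie_sum g x chi l j =
     on_lines (tie g l j) (x l) + on_lines (tie g l j) (x j) + chi (tie g l j)"

definition S1a_objective :: "('n :: finite) microgrid \<Rightarrow> real \<Rightarrow> (nat \<Rightarrow> 'n currents) \<Rightarrow>
    (('n \<times> 'n) set \<Rightarrow> 'n currents) \<Rightarrow> (nat \<Rightarrow> nat \<Rightarrow> 'n currents) \<Rightarrow> nat \<Rightarrow>
    'n currents \<times> 'n dg_powers \<Rightarrow> real" where
  "S1a_objective g \<kappa> x chi gam l = (\<lambda>(\<xi>, \<sigma>).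
     area_cost g l (\<xi>, \<sigma>) + (\<Sum>e\<in>area_switched g l. area_weight g l * norm (\<xi> $ e))
   + (\<Sum>j\<in>neighbors g l.
        gam l j \<bullet> on_lines (tie g l j) \<xi>
        + \<kappa> / 2 * (norm (on_lines (tie g l j) \<xi>))\<^sup>2
        - \<kappa> / 3 * (on_lines (tie g l j) \<xi> \<bullet> tie_sum g x chi l j)))"

definition S1b_objective :: "('n :: finite) microgrid \<Rightarrow> real \<Rightarrow> (nat \<Rightarrow> 'n currents) \<Rightarrow>
    (('n \<times> 'n) set \<Rightarrow> 'n currents) \<Rightarrow> (('n \<times> 'n) set \<Rightarrow> 'n currents) \<Rightarrow> nat \<Rightarrow> nat \<Rightarrow>
    'n currents \<Rightarrow> real" where
  "S1b_objective g \<kappa> x chi mu l j = (\<lambda>c.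
     tie_cost g (tie g l j) c + tie_weight g (tie g l j) * norm c + \<kappa> / 2 * (norm c)\<^sup>2
     - c \<bullet> (mu (tie g l j) + (\<kappa> / 3) *\<^sub>R tie_sum g x chi l j))"

definition S1a_step where
  "S1a_step g \<kappa> x s chi gam i \<longleftrightarrow>
     (\<forall>l\<in>{1..num_areas g}.
        is_arg_min (S1a_objective g \<kappa> (x i) (chi i) (gam i) l) (\<lambda>p. p \<in> area_feasible g l)
          (x (Suc i) l, s (Suc i) l))"

definition S1b_step where
  "S1b_step g \<kappa> x chi mu i \<longleftrightarrow>
     (\<forall>l\<in>{1..num_areas g}. \<forall>j\<in>neighbors g l.
        is_arg_min (S1b_objective g \<kappa> (x i) (chi i) (mu i) l j)
          (\<lambda>c. c \<in> current_space g (tie g l j) \<and> within_caps g (tie g l j) c)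
          (chi (Suc i) (tie g l j)))"

definition S2_step where
  "S2_step g \<kappa> x chi gam mu i \<longleftrightarrow>
     (\<forall>l\<in>{1..num_areas g}. \<forall>j\<in>neighbors g l.
        gam (Suc i) l j = gam i l j + (\<kappa> / 3) *\<^sub>R
          (2 *\<^sub>R on_lines (tie g l j) (x (Suc i) l) - on_lines (tie g l j) (x (Suc i) j)
             - chi (Suc i) (tie g l j)) \<and>
        mu (Suc i) (tie g l j) = mu i (tie g l j) + (\<kappa> / 3) *\<^sub>R
          (on_lines (tie g l j) (x (Suc i) l) + on_lines (tie g l j) (x (Suc i) j)
             - 2 *\<^sub>R chi (Suc i) (tie g l j)))"

text \<open>The starting point need not be feasible; it only has to consist of vectors of the right spaces.\<close>

definition initial_point :: "('n :: finite) microgrid \<Rightarrow> (nat \<Rightarrow> 'n currents) \<Rightarrow>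
    (nat \<Rightarrow> 'n dg_powers) \<Rightarrow> (('n \<times> 'n) set \<Rightarrow> 'n currents) \<Rightarrow> bool" where
  "initial_point g x s chi \<longleftrightarrow>
     (\<forall>l\<in>{1..num_areas g}.
        x l \<in> current_space g (area_lines g l) \<and> s l \<in> dg_space g (area g l) \<and>
        (\<forall>j\<in>neighbors g l. chi (tie g l j) \<in> current_space g (tie g l j)))"

end

theory Submission
  imports Defs
begin

text \<open>
  The iterations are the alternating direction method of multipliers for a consensus form of the
  problem. There are two kinds of agents: an area, with its own version of all the currents it sees, and
  a pair of neighboring areas, with a further copy of the currents on the lines joining them. The
  currents on such tie lines occur in three versions, which are required to agree with a common
  consensus variable. In the iterations this variable is the average of the three versions, and the
  balance \<open>gam i l j + gam i j l = mu i (tie g l j)\<close>, preserved from the initialization with zero, is the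
  condition for the multipliers to annihilate it.

  Convergence then follows from the energy argument for this method (theorem \<open>convergence\<close> in the locale
  \<open>consensus_admm\<close>). Given one saddle point of the Lagrangian, the weighted squared distance of the
  consensus variable and the multipliers from it decreases in each step at least by the squared length
  of the step. So the steps tend to zero, the iterates stay bounded, and each limit point is again a saddle
  point. Its primal part solves the problem and is therefore the given unique solution. The energy may
  also be measured from a limit point itself; since it decreases and gets arbitrarily small, the
  multipliers have a single limit.

  It remains to find a saddle point. By a sum rule for convex functions (\<open>convex_sum_rule\<close>), an optimal
  point of the global problem minimizes each agent's cost plus a linear form, over the constraints of
  that agent, where the linear forms add up to zero (\<open>exists_multipliers\<close>). Slater's condition provides
  an interior point only with respect to the caps on the currents. The remaining constraints are affine,
  and may be tight at all feasible points; for them separation is replaced by Farkas' lemma.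
\<close>

section \<open>Polyhedra and their normal cones\<close>

text \<open>
  The separating hyperplane can be moved to the origin, because a linear form that is bounded below
  on a cone is nonnegative there.
\<close>

lemma closed_cone_separation:
  fixes K :: "'a :: euclidean_space set"
  assumes "convex_cone K" and "closed K" and "v \<notin> K"
  obtains h where "0 < h \<bullet> v" and "\<And>a. a \<in> K \<Longrightarrow> h \<bullet> a \<le> 0"
proof -
  obtain c b where cv: "c \<bullet> v < b" and cK: "\<And>x. x \<in> K \<Longrightarrow> b < c \<bullet> x"
    using separating_hyperplane_closed_point[of K v] assms by (auto simp: convex_cone_def)
  have "b < 0"
    using cK[of 0] assms(1) by (simp add: convex_cone_iff)
  have "0 \<le> c \<bullet> a" if "a \<in> K" for a
  proof (rule ccontr)
    assume "\<not> 0 \<le> c \<bullet> a"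
    then have "(b / (c \<bullet> a)) *\<^sub>R a \<in> K"
      using \<open>b < 0\<close> that assms(1) by (intro convex_cone_scaleR) (auto simp: divide_nonpos_nonpos)
    from cK[OF this] \<open>\<not> 0 \<le> c \<bullet> a\<close> show False
      by simp
  qed
  then show thesis
    using that[of "- c"] cv \<open>b < 0\<close> by simp
qed

text \<open>
  The vector \<open>v\<close> belongs to the normal cone of \<open>S\<close> at \<open>p\<close>.
\<close>

definition normal_at :: "'a :: real_inner set \<Rightarrow> 'a \<Rightarrow> 'a \<Rightarrow> bool" where
  "normal_at S p v \<longleftrightarrow> (\<forall>q\<in>S. v \<bullet> q \<le> v \<bullet> p)"

text \<open>
  A short move away from \<open>p\<close> violates only constraints that are tight at \<open>p\<close>, since the finitely many
  others leave some slack. The set \<open>A\<close> consists of the normals of the tight constraints.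
\<close>

lemma polyhedron_active_normals:
  fixes P :: "'a :: euclidean_space set"
  assumes "polyhedron P" and "p \<in> P"
  obtains A where "finite A" and "\<And>a. a \<in> A \<Longrightarrow> normal_at P p a"
    and "\<And>h. (\<And>a. a \<in> A \<Longrightarrow> a \<bullet> h \<le> 0) \<Longrightarrow> \<exists>t>0. p + t *\<^sub>R h \<in> P"
proof -
  obtain F where F: "finite F" "P = \<Inter>F" "\<forall>h\<in>F. \<exists>a b. a \<noteq> 0 \<and> h = {x. a \<bullet> x \<le> b}"
    using assms(1) by (auto simp: polyhedron_def)
  then obtain a b where ab: "\<And>h. h \<in> F \<Longrightarrow> h = {x. a h \<bullet> x \<le> b h}"
    by metis
  have P: "q \<in> P \<longleftrightarrow> (\<forall>k\<in>F. a k \<bullet> q \<le> b k)" for q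
    using F(2) ab by blast
  define A where "A = a ` {k \<in> F. a k \<bullet> p = b k}"
  show thesis
  proof
    show "finite A"
      using F(1) by (simp add: A_def)
    show "normal_at P p v" if "v \<in> A" for v
      using that by (auto simp: A_def normal_at_def P)
  next
    fix h
    assume h: "\<And>v. v \<in> A \<Longrightarrow> v \<bullet> h \<le> 0"
    have "\<forall>\<^sub>F t in at_right 0. a k \<bullet> (p + t *\<^sub>R h) \<le> b k" if k: "k \<in> F" for k
    proof (cases "a k \<bullet> p = b k")
      case True
      then have "a k \<bullet> h \<le> 0"
        using h k by (auto simp: A_def)
      then have "a k \<bullet> (p + t *\<^sub>R h) \<le> b k" if "0 < t" for t
        using that True by (simp add: inner_add_right mult_nonneg_nonpos)
      then show ?thesis
        by (auto intro: eventually_at_right_less eventually_mono)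
    next
      case False
      then have "a k \<bullet> (p + 0 *\<^sub>R h) < b k"
        using assms(2) k P by (simp add: order.not_eq_order_implies_strict)
      moreover have "((\<lambda>t. a k \<bullet> (p + t *\<^sub>R h)) \<longlongrightarrow> a k \<bullet> (p + 0 *\<^sub>R h)) (at_right 0)"
        by (intro tendsto_intros)
      ultimately have "\<forall>\<^sub>F t in at_right 0. a k \<bullet> (p + t *\<^sub>R h) < b k"
        by (simp add: order_tendstoD(2))
      then show ?thesis
        by (rule eventually_mono) simp
    qed
    then have "\<forall>\<^sub>F t in at_right 0. 0 < t \<and> p + t *\<^sub>R h \<in> P"
      using F(1) by (simp add: P eventually_ball_finite eventually_conj eventually_at_right_less)
    then show "\<exists>t>0. p + t *\<^sub>R h \<in> P"
      using eventually_happens trivial_limit_at_right_real by blast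
  qed
qed

text \<open>
  A form of Farkas' lemma. The cone generated by the tight normals of both polyhedra is closed, being
  finitely generated; were \<open>v\<close> outside it, a separating direction would be feasible for both polyhedra
  and increase \<open>v\<close>. Polyhedra matter here: for two discs that touch in one point every vector is
  normal to the intersection, but the two normal cones span only a line.
\<close>

lemma normal_at_Int_polyhedra:
  fixes P :: "'a :: euclidean_space set"
  assumes "polyhedron P" "polyhedron Q" "p \<in> P" "p \<in> Q" "normal_at (P \<inter> Q) p v"
  obtains u w where "v = u + w" "normal_at P p u" "normal_at Q p w"
proof -
  obtain A where A: "finite A" "\<And>a. a \<in> A \<Longrightarrow> normal_at P p a"
    "\<And>h. (\<And>a. a \<in> A \<Longrightarrow> a \<bullet> h \<le> 0) \<Longrightarrow> \<exists>t>0. p + t *\<^sub>R h \<in> P"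
    using polyhedron_active_normals[OF assms(1,3)] by metis
  obtain B where B: "finite B" "\<And>a. a \<in> B \<Longrightarrow> normal_at Q p a"
    "\<And>h. (\<And>a. a \<in> B \<Longrightarrow> a \<bullet> h \<le> 0) \<Longrightarrow> \<exists>t>0. p + t *\<^sub>R h \<in> Q"
    using polyhedron_active_normals[OF assms(2,4)] by metis
  have hull: "normal_at S p u" if "u \<in> convex_cone hull N" "\<And>a. a \<in> N \<Longrightarrow> normal_at S p a" for S N u
  proof -
    have "convex_cone {a. normal_at S p a}"
      by (auto simp: convex_cone_iff normal_at_def inner_add_left add_mono mult_left_mono)
    with that show ?thesis
      using hull_minimal[of N "{a. normal_at S p a}" convex_cone] by blast
  qed
  have "v \<in> convex_cone hull (A \<union> B)"
  proof (rule ccontr)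
    assume "v \<notin> convex_cone hull (A \<union> B)"
    then obtain h where h: "0 < h \<bullet> v" "\<And>a. a \<in> convex_cone hull (A \<union> B) \<Longrightarrow> h \<bullet> a \<le> 0"
      using closed_cone_separation[OF convex_cone_convex_cone_hull closed_convex_cone_hull[of "A \<union> B"]]
        A(1) B(1) by (metis finite_UnI)
    have le: "a \<bullet> h \<le> 0" if "a \<in> A \<union> B" for a
      using h(2) that hull_inc by (metis inner_commute)
    obtain r where r: "r > 0" "p + r *\<^sub>R h \<in> P"
      using A(3)[of h] le by blast
    obtain t where t: "t > 0" "p + t *\<^sub>R h \<in> Q"
      using B(3)[of h] le by blast
    \<comment> \<open>moves of different length that are feasible for P and for Q are cut to their common length\<close>
    have shrink: "p + m *\<^sub>R h \<in> S" if "0 < m" "m \<le> c" "p + c *\<^sub>R h \<in> S" "convex S" "p \<in> S" for m c S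
    proof -
      have "(1 - m / c) *\<^sub>R p + (m / c) *\<^sub>R (p + c *\<^sub>R h) \<in> S"
        using that by (intro convexD) (auto simp: field_simps)
      moreover have "(1 - m / c) *\<^sub>R p + (m / c) *\<^sub>R (p + c *\<^sub>R h) = p + m *\<^sub>R h"
        using that by (simp add: algebra_simps)
      ultimately show ?thesis
        by simp
    qed
    have "p + min r t *\<^sub>R h \<in> P \<inter> Q"
      using shrink[of "min r t" r P] shrink[of "min r t" t Q] r t assms(1-4)
      by (auto simp: polyhedron_imp_convex)
    then have "v \<bullet> (p + min r t *\<^sub>R h) \<le> v \<bullet> p"
      using assms(5) by (simp add: normal_at_def)
    then have "min r t * (h \<bullet> v) \<le> 0"
      by (simp add: inner_add_right inner_commute)
    then show False
      using r(1) t(1) h(1) by (simp add: mult_le_0_iff not_le min_def split: if_splits)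
  qed
  then obtain u w where "u \<in> convex_cone hull A" "w \<in> convex_cone hull B" "v = u + w"
    by (auto simp: convex_cone_hull_Un)
  with that hull A(2) B(2) show thesis
    by metis
qed

lemma normal_at_INT_polyhedra:
  fixes P :: "'k \<Rightarrow> 'a :: euclidean_space set"
  assumes "finite I" and "\<And>k. k \<in> I \<Longrightarrow> polyhedron (P k) \<and> p \<in> P k"
    and "normal_at (\<Inter>k\<in>I. P k) p v"
  shows "\<exists>w. v = (\<Sum>k\<in>I. w k) \<and> (\<forall>k\<in>I. normal_at (P k) p (w k))"
  using assms
proof (induction I arbitrary: v)
  case empty
  then have "v \<bullet> (p + v) \<le> v \<bullet> p"
    unfolding normal_at_def by blast
  then show ?case
    by (simp add: inner_add_right flip: power2_norm_eq_inner)
next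
  case (insert k I)
  have "polyhedron (\<Inter>j\<in>I. P j)"
    using insert.hyps insert.prems by auto
  then obtain u w where uw: "v = u + w" "normal_at (P k) p u" "normal_at (\<Inter>j\<in>I. P j) p w"
    using normal_at_Int_polyhedra[of "P k" "\<Inter>j\<in>I. P j" p v] insert.prems by auto
  then obtain c where c: "w = (\<Sum>j\<in>I. c j)" "\<forall>j\<in>I. normal_at (P j) p (c j)"
    using insert.IH insert.prems by blast
  have "v = (\<Sum>j\<in>insert k I. (c(k := u)) j)" "\<forall>j\<in>insert k I. normal_at (P j) p ((c(k := u)) j)"
    using uw c insert.hyps by (auto intro!: sum.cong)
  then show ?case
    by blast
qed

lemma polyhedron_linear_le:
  fixes h :: "'a :: euclidean_space \<Rightarrow> real"
  assumes "linear h"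
  shows "polyhedron {p. h p \<le> c}"
proof -
  have "h p = adjoint h 1 \<bullet> p" for p
    using adjoint_works[OF assms, of p 1] by (simp add: inner_commute)
  then show ?thesis
    by (simp add: polyhedron_halfspace_le)
qed

lemma polyhedron_Collect_conj: "polyhedron {p. P p} \<Longrightarrow> polyhedron {p. Q p} \<Longrightarrow> polyhedron {p. P p \<and> Q p}"
  by (simp add: Collect_conj_eq)

lemma polyhedron_Collect_imp: "(P \<Longrightarrow> polyhedron {p. Q p}) \<Longrightarrow> polyhedron {p. P \<longrightarrow> Q p}"
  by (cases P) auto

lemma polyhedron_Collect_ball:
  assumes "finite A" "\<And>k. k \<in> A \<Longrightarrow> polyhedron {p. P k p}"
  shows "polyhedron {p. \<forall>k\<in>A. P k p}"
proof -
  have "{p. \<forall>k\<in>A. P k p} = (\<Inter>k\<in>A. {p. P k p})"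
    by auto
  then show ?thesis
    using assms by auto
qed

lemma polyhedron_Collect_all:
  fixes P :: "'k :: finite \<Rightarrow> _"
  shows "(\<And>k. polyhedron {p. P k p}) \<Longrightarrow> polyhedron {p. \<forall>k. P k p}"
  using polyhedron_Collect_ball[of "UNIV :: 'k set" P] by simp

section \<open>A sum rule for constrained convex minimization\<close>

lemma convex_on_finite_sum:
  assumes "finite I" "\<And>k. k \<in> I \<Longrightarrow> convex_on S (f k)" "convex S"
  shows "convex_on S (\<lambda>x. \<Sum>k\<in>I. f k x)"
  using assms by (induction I) (auto simp: convex_on_const intro!: convex_on_add)

lemma convex_on_add_linear:
  "convex_on S f \<Longrightarrow> convex_on S (\<lambda>x. f x + v \<bullet> x)"
  by (rule convex_on_add) (auto simp: convex_on_def inner_add_right)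

lemma convex_on_compose_linear:
  assumes "convex_on S f" "linear h" "\<And>x. h x \<in> S"
  shows "convex_on UNIV (\<lambda>x. f (h x))"
  using assms by (auto simp: convex_on_def linear_add linear_scale)

lemma convex_on_norm_UNIV: "convex_on UNIV (norm :: 'a :: real_normed_vector \<Rightarrow> real)"
  using convex_on_dist[of "UNIV :: 'a set" 0] by simp

text \<open>
  On the segment from \<open>x\<close> to the interior point \<open>z\<close> all points except \<open>x\<close> are interior, and \<open>h\<close> lies
  below its chord.
\<close>

lemma convex_le_extend_from_interior:
  fixes h :: "'a :: euclidean_space \<Rightarrow> real"
  assumes "convex_on UNIV h" "convex C" "z \<in> interior C" "x \<in> C"
    and "\<And>y. y \<in> interior C \<Longrightarrow> m \<le> h y"
  shows "m \<le> h x"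
proof -
  have "m \<le> (1 - t) * h x + t * h z" if "0 < t" "t \<le> 1" for t
  proof -
    have "x - t *\<^sub>R (x - z) \<in> interior C"
      using that assms by (intro mem_interior_convex_shrink) auto
    moreover have "h ((1 - t) *\<^sub>R x + t *\<^sub>R z) \<le> (1 - t) * h x + t * h z"
      using assms(1) that by (simp add: convex_on_def)
    ultimately show ?thesis
      using assms(5)[of "(1 - t) *\<^sub>R x + t *\<^sub>R z"] by (simp add: algebra_simps)
  qed
  then have ev: "\<forall>\<^sub>F t in at_right 0. m \<le> (1 - t) * h x + t * h z"
    unfolding eventually_at_right_field by (intro exI[of _ 1]) auto
  have "((\<lambda>t. (1 - t) * h x + t * h z) \<longlongrightarrow> h x) (at_right 0)"
    by (auto intro!: tendsto_eq_intros)
  from tendsto_lowerbound[OF this ev] show ?thesis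
    by simp
qed

text \<open>
  Minimality says that the strict epigraph of \<open>f\<close> over the interior of \<open>C\<close> does not meet the hypograph of
  \<open>f p + g p - g\<close> over \<open>Q\<close>. A hyperplane separating them is the graph of an affine function, whose
  slope is \<open>- v\<close>: it cannot be vertical, because \<open>z\<close> lies in \<open>Q\<close> and in the interior of \<open>C\<close>.
\<close>

lemma convex_min_split:
  fixes f :: "'a :: euclidean_space \<Rightarrow> real"
  assumes f: "convex_on UNIV f" and g: "convex_on Q g" and C: "convex C"
    and z: "z \<in> interior C" "z \<in> Q" and p: "p \<in> C" "p \<in> Q"
    and min: "\<And>x. x \<in> C \<Longrightarrow> x \<in> Q \<Longrightarrow> f p + g p \<le> f x + g x"
  obtains v where "\<And>x. x \<in> C \<Longrightarrow> f p + v \<bullet> p \<le> f x + v \<bullet> x"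
    and "\<And>y. y \<in> Q \<Longrightarrow> g p - v \<bullet> p \<le> g y - v \<bullet> y"
proof -
  define M where "M = f p + g p"
  define A where "A = {(x, t). x \<in> interior C \<and> f x < t}"
  define B where "B = {(x, t). x \<in> Q \<and> t \<le> M - g x}"
  have "convex A"
    unfolding convex_def A_def
  proof (clarsimp, intro conjI)
    fix x s y t and u v :: real
    assume *: "x \<in> interior C" "f x < s" "y \<in> interior C" "f y < t" "0 \<le> u" "0 \<le> v" "u + v = 1"
    then show "u *\<^sub>R x + v *\<^sub>R y \<in> interior C"
      using convexD[OF convex_interior[OF C]] by blast
    have "f (u *\<^sub>R x + v *\<^sub>R y) \<le> u * f x + v * f y"
      using f * by (simp add: convex_on_def)
    also have "\<dots> < u * s + v * t"
      using * by (cases "u = 0") (auto intro!: add_less_le_mono mult_strict_left_mono mult_left_mono)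
    finally show "f (u *\<^sub>R x + v *\<^sub>R y) < u * s + v * t" .
  qed
  moreover have "convex B"
    unfolding convex_def B_def
  proof (clarsimp, intro conjI)
    fix x s y t and u v :: real
    assume *: "x \<in> Q" "s \<le> M - g x" "y \<in> Q" "t \<le> M - g y" "0 \<le> u" "0 \<le> v" "u + v = 1"
    then show "u *\<^sub>R x + v *\<^sub>R y \<in> Q"
      using g by (auto simp: convex_on_def convex_def)
    have "u * s + v * t \<le> u * (M - g x) + v * (M - g y)"
      using * by (intro add_mono mult_left_mono) auto
    also have "\<dots> = M - (u * g x + v * g y)"
      using \<open>u + v = 1\<close> by (simp add: algebra_simps flip: distrib_left)
    also have "\<dots> \<le> M - g (u *\<^sub>R x + v *\<^sub>R y)"
    proof -
      have "g (u *\<^sub>R x + v *\<^sub>R y) \<le> u * g x + v * g y"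
        using g * unfolding convex_on_def by blast
      then show ?thesis
        by simp
    qed
    finally show "u * s + v * t \<le> M - g (u *\<^sub>R x + v *\<^sub>R y)" .
  qed
  moreover have "(z, f z + 1) \<in> A" "(z, M - g z) \<in> B"
    using z by (auto simp: A_def B_def)
  moreover have "A \<inter> B = {}"
    using min interior_subset by (fastforce simp: A_def B_def M_def)
  ultimately obtain a b where ab: "a \<noteq> 0" "\<forall>q\<in>A. a \<bullet> q \<le> b" "\<forall>q\<in>B. b \<le> a \<bullet> q"
    using separating_hyperplane_sets[of A B] by blast
  obtain w r where a: "a = (w, r)"
    by (cases a)
  have sep: "w \<bullet> x + r * t \<le> w \<bullet> y + r * s"
    if "x \<in> interior C" "f x < t" "y \<in> Q" "s \<le> M - g y" for x t y s
    using ab(2)[rule_format, of "(x, t)"] ab(3)[rule_format, of "(y, s)"] that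
    by (simp add: A_def B_def a)
  \<comment> \<open>points of A reach arbitrarily high, points of B arbitrarily low, so the last coordinate r of the normal is not positive\<close>
  have "r \<le> 0"
  proof (rule ccontr)
    assume "\<not> r \<le> 0"
    have "r * (max (f z) (M - g z) + 1) \<le> r * (M - g z)"
      using sep[of z "max (f z) (M - g z) + 1" z "M - g z"] z by simp
    with \<open>\<not> r \<le> 0\<close> show False
      by (simp add: mult_le_cancel_left)
  qed
  \<comment> \<open>a vertical hyperplane through z would cut a ball around z that lies in C\<close>
  moreover have "r \<noteq> 0"
  proof
    assume "r = 0"
    obtain e where e: "e > 0" "cball z e \<subseteq> interior C"
      using z(1) open_contains_cball by (metis open_interior)
    have "w \<noteq> 0"
      using ab(1) a \<open>r = 0\<close> by (auto simp: zero_prod_def)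
    have "z + (e / norm w) *\<^sub>R w \<in> interior C"
      using e \<open>w \<noteq> 0\<close> by (intro e(2)[THEN subsetD]) (simp add: dist_norm)
    from sep[OF this, of _ z "M - g z"] \<open>r = 0\<close> z(2) have "e / norm w * (w \<bullet> w) \<le> 0"
      using gt_ex by (auto simp: inner_add_right)
    moreover have "0 < e / norm w * (w \<bullet> w)"
      using e(1) \<open>w \<noteq> 0\<close> by simp
    ultimately show False
      by simp
  qed
  ultimately have "r < 0"
    by simp
  define v where "v = (1 / r) *\<^sub>R w"
  have wv: "w \<bullet> x = r * (v \<bullet> x)" for x
    using \<open>r < 0\<close> by (simp add: v_def)
  have ge: "M - g y + v \<bullet> y \<le> f x + v \<bullet> x" if "x \<in> interior C" "y \<in> Q" for x y
  proof (rule dense_ge)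
    fix t
    assume "f x + v \<bullet> x < t"
    then have "r * (v \<bullet> x + (t - v \<bullet> x)) \<le> r * (v \<bullet> y + (M - g y))"
      using sep[of x "t - v \<bullet> x" y "M - g y"] that by (simp add: wv flip: distrib_left)
    with \<open>r < 0\<close> show "M - g y + v \<bullet> y \<le> t"
      by (simp add: mult_le_cancel_left)
  qed
  have "convex_on UNIV (\<lambda>x. v \<bullet> x)"
    by (simp add: convex_on_def inner_add_right)
  then have "convex_on UNIV (\<lambda>x. f x + v \<bullet> x)"
    using f by (rule convex_on_add[rotated])
  then have all: "M - g y + v \<bullet> y \<le> f x + v \<bullet> x" if "x \<in> C" "y \<in> Q" for x y
    using convex_le_extend_from_interior[OF _ C z(1) that(1)] ge that(2) by blast
  show thesis
    by (rule that[of v]) (use all[OF _ p(2)] all[OF p(1)] in \<open>force simp: M_def\<close>)+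
qed

text \<open>
  The functions are split off one after the other; the linear term \<open>w\<close> collects the slopes that were
  given to the functions treated before.
\<close>

lemma convex_sum_min_split:
  fixes f :: "'k \<Rightarrow> 'a :: euclidean_space \<Rightarrow> real"
  assumes "finite I"
    and "\<And>k. k \<in> I \<Longrightarrow> convex_on UNIV (f k) \<and> convex (C k) \<and> z \<in> interior (C k) \<and> p \<in> C k"
    and "convex Q" "z \<in> Q" "p \<in> Q"
    and "\<And>x. x \<in> Q \<Longrightarrow> (\<forall>k\<in>I. x \<in> C k) \<Longrightarrow>
           (\<Sum>k\<in>I. f k p) + w \<bullet> p \<le> (\<Sum>k\<in>I. f k x) + w \<bullet> x"
  shows "\<exists>v. (\<forall>k\<in>I. \<forall>x\<in>C k. f k p + v k \<bullet> p \<le> f k x + v k \<bullet> x) \<and>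
             normal_at Q p ((\<Sum>k\<in>I. v k) - w)"
  using assms
proof (induction I arbitrary: w)
  case empty
  then show ?case
    by (simp add: normal_at_def)
next
  case (insert k I)
  define D where "D = Q \<inter> (\<Inter>j\<in>I. C j)"
  have conv: "convex_on D (\<lambda>x. (\<Sum>j\<in>I. f j x) + w \<bullet> x)"
    unfolding D_def using insert.hyps(1) insert.prems(1,2)
    by (intro convex_on_add_linear convex_on_finite_sum)
       (auto intro!: convex_Int convex_INT intro: convex_on_subset)
  obtain v where v: "\<And>x. x \<in> C k \<Longrightarrow> f k p + v \<bullet> p \<le> f k x + v \<bullet> x"
    "\<And>y. y \<in> D \<Longrightarrow> (\<Sum>j\<in>I. f j p) + w \<bullet> p - v \<bullet> p \<le> (\<Sum>j\<in>I. f j y) + w \<bullet> y - v \<bullet> y"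
  proof (rule convex_min_split[OF _ conv, of "f k" "C k" z p])
    show "z \<in> D"
      using insert.prems interior_subset by (fastforce simp: D_def)
    fix x
    assume "x \<in> C k" "x \<in> D"
    then show "f k p + ((\<Sum>j\<in>I. f j p) + w \<bullet> p) \<le> f k x + ((\<Sum>j\<in>I. f j x) + w \<bullet> x)"
      using insert.prems(5)[of x] insert.hyps by (simp add: D_def)
  qed (use insert.prems in \<open>auto simp: D_def\<close>)
  have "\<exists>u. (\<forall>j\<in>I. \<forall>x\<in>C j. f j p + u j \<bullet> p \<le> f j x + u j \<bullet> x) \<and>
             normal_at Q p ((\<Sum>j\<in>I. u j) - (w - v))"
    using insert.prems v(2) by (intro insert.IH) (auto simp: D_def inner_diff_left add_diff_eq)
  then obtain u where u: "\<forall>j\<in>I. \<forall>x\<in>C j. f j p + u j \<bullet> p \<le> f j x + u j \<bullet> x"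
    "normal_at Q p ((\<Sum>j\<in>I. u j) - (w - v))"
    by blast
  have "(\<Sum>j\<in>insert k I. (u(k := v)) j) = v + (\<Sum>j\<in>I. u j)"
    using insert.hyps by (auto intro!: sum.cong)
  then have "normal_at Q p ((\<Sum>j\<in>insert k I. (u(k := v)) j) - w)"
    using u(2) by (simp add: algebra_simps)
  moreover have "\<forall>j\<in>insert k I. \<forall>x\<in>C j. f j p + (u(k := v)) j \<bullet> p \<le> f j x + (u(k := v)) j \<bullet> x"
    using u(1) v(1) insert.hyps by auto
  ultimately show ?case
    by blast
qed

text \<open>
  A subdifferential sum rule for functions restricted to convex sets. The two kinds of constraints are
  treated differently: the common point \<open>z\<close> has to be interior to the sets \<open>C k\<close>, which are detached
  by separation, but only to belong to the polyhedra \<open>P k\<close>, whose normal cones add up by Farkas' lemma.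
  This is how Slater's condition for the nonlinear constraints alone produces multipliers.
\<close>

theorem convex_sum_rule:
  fixes f :: "'k \<Rightarrow> 'a :: euclidean_space \<Rightarrow> real"
  assumes "finite I"
    and fC: "\<And>k. k \<in> I \<Longrightarrow> convex_on UNIV (f k) \<and> convex (C k) \<and> z \<in> interior (C k) \<and> p \<in> C k"
    and P: "\<And>k. k \<in> I \<Longrightarrow> polyhedron (P k) \<and> z \<in> P k \<and> p \<in> P k"
    and min: "\<And>x. (\<forall>k\<in>I. x \<in> C k \<inter> P k) \<Longrightarrow> (\<Sum>k\<in>I. f k p) \<le> (\<Sum>k\<in>I. f k x)"
  obtains v where "(\<Sum>k\<in>I. v k) = 0"
    and "\<And>k x. k \<in> I \<Longrightarrow> x \<in> C k \<inter> P k \<Longrightarrow> f k p + v k \<bullet> p \<le> f k x + v k \<bullet> x"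
proof -
  have "\<exists>v. (\<forall>k\<in>I. \<forall>x\<in>C k. f k p + v k \<bullet> p \<le> f k x + v k \<bullet> x) \<and>
             normal_at (\<Inter>k\<in>I. P k) p ((\<Sum>k\<in>I. v k) - 0)"
    using assms by (intro convex_sum_min_split) (auto intro!: convex_INT polyhedron_imp_convex)
  then obtain v where v: "\<forall>k\<in>I. \<forall>x\<in>C k. f k p + v k \<bullet> p \<le> f k x + v k \<bullet> x"
    "normal_at (\<Inter>k\<in>I. P k) p (\<Sum>k\<in>I. v k)"
    by auto
  then obtain w where w: "(\<Sum>k\<in>I. v k) = (\<Sum>k\<in>I. w k)" "\<forall>k\<in>I. normal_at (P k) p (w k)"
    using normal_at_INT_polyhedra[OF assms(1), of P p "\<Sum>k\<in>I. v k"] P by blast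
  show thesis
  proof
    show "(\<Sum>k\<in>I. v k - w k) = 0"
      using w(1) by (simp add: sum_subtractf)
    show "f k p + (v k - w k) \<bullet> p \<le> f k x + (v k - w k) \<bullet> x" if "k \<in> I" "x \<in> C k \<inter> P k" for k x
    proof -
      have "f k p + v k \<bullet> p \<le> f k x + v k \<bullet> x" "w k \<bullet> x \<le> w k \<bullet> p"
        using v(1) w(2) that by (auto simp: normal_at_def)
      then show ?thesis
        by (simp add: inner_diff_left)
    qed
  qed
qed

section \<open>Convergence of the alternating direction method of multipliers\<close>

text \<open>
  First order optimality: compare \<open>y\<close> with points on the segment to \<open>u\<close> and let them tend to \<open>y\<close>. The
  convex function keeps its values, the quadratic term is replaced by its gradient.
\<close>

lemma convex_quadratic_min_variational:
  fixes f :: "'a :: real_vector \<Rightarrow> real" and B :: "'a \<Rightarrow> 'b :: real_inner"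
  assumes f: "convex_on Y f" and B: "linear B" and y: "y \<in> Y" and u: "u \<in> Y" and "0 \<le> \<kappa>"
    and min: "\<And>u. u \<in> Y \<Longrightarrow> f y + d \<bullet> B y + \<kappa> / 2 * (norm (B y - z))\<^sup>2
                           \<le> f u + d \<bullet> B u + \<kappa> / 2 * (norm (B u - z))\<^sup>2"
  shows "f y + (d + \<kappa> *\<^sub>R (B y - z)) \<bullet> B y \<le> f u + (d + \<kappa> *\<^sub>R (B y - z)) \<bullet> B u"
proof -
  define h where "h = B u - B y"
  define q where "q = B y - z"
  have key: "0 \<le> f u - f y + d \<bullet> h + \<kappa> * (q \<bullet> h) + t * (\<kappa> / 2 * (norm h)\<^sup>2)" if "0 < t" "t \<le> 1" for t
  proof -
    define w where "w = (1 - t) *\<^sub>R y + t *\<^sub>R u"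
    have "w \<in> Y"
      using convex_on_imp_convex[OF f] y u that by (auto simp: w_def convex_def)
    have Bw: "B w = B y + t *\<^sub>R h"
    proof -
      have "B w = (1 - t) *\<^sub>R B y + t *\<^sub>R B u"
        by (simp add: w_def linear_add[OF B] linear_scale[OF B])
      then show ?thesis
        by (simp add: h_def algebra_simps)
    qed
    have "(norm (B w - z))\<^sup>2 = (norm (q + t *\<^sub>R h))\<^sup>2"
      by (simp add: Bw q_def algebra_simps)
    also have "\<dots> = (norm q)\<^sup>2 + 2 * t * (q \<bullet> h) + t\<^sup>2 * (norm h)\<^sup>2"
      unfolding power2_norm_eq_inner inner_add_left inner_add_right
      by (simp add: inner_commute power2_eq_square)
    finally have "(norm (B w - z))\<^sup>2 = (norm q)\<^sup>2 + 2 * t * (q \<bullet> h) + t\<^sup>2 * (norm h)\<^sup>2" .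
    moreover have "f w \<le> (1 - t) * f y + t * f u"
      using f y u that by (simp add: convex_on_def w_def)
    ultimately have "0 \<le> t * (f u - f y) + t * (d \<bullet> h) + \<kappa> * t * (q \<bullet> h) + \<kappa> / 2 * (t\<^sup>2 * (norm h)\<^sup>2)"
      using min[OF \<open>w \<in> Y\<close>] by (simp add: Bw q_def[symmetric] inner_add_right algebra_simps)
    also have "\<dots> = t * (f u - f y + d \<bullet> h + \<kappa> * (q \<bullet> h) + t * (\<kappa> / 2 * (norm h)\<^sup>2))"
      by (simp add: algebra_simps power2_eq_square)
    finally show ?thesis
      using that(1) by (simp add: zero_le_mult_iff)
  qed
  then have ev: "\<forall>\<^sub>F t in at_right 0. 0 \<le> f u - f y + d \<bullet> h + \<kappa> * (q \<bullet> h) + t * (\<kappa> / 2 * (norm h)\<^sup>2)"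
    unfolding eventually_at_right_field by (intro exI[of _ 1]) auto
  have "((\<lambda>t. f u - f y + d \<bullet> h + \<kappa> * (q \<bullet> h) + t * (\<kappa> / 2 * (norm h)\<^sup>2))
          \<longlongrightarrow> f u - f y + d \<bullet> h + \<kappa> * (q \<bullet> h)) (at_right 0)"
    by (auto intro!: tendsto_eq_intros)
  from tendsto_lowerbound[OF this ev] show ?thesis
    by (simp add: h_def inner_diff_right inner_add_left right_diff_distrib flip: q_def)
qed

lemma convergent_subsequences_finite_family:
  fixes y :: "nat \<Rightarrow> 'k \<Rightarrow> 'a :: metric_space"
  assumes "finite I" and "\<And>k. k \<in> I \<Longrightarrow> compact (K k)" and "\<And>n k. k \<in> I \<Longrightarrow> y n k \<in> K k"
  shows "\<exists>l r. strict_mono r \<and> (\<forall>k\<in>I. l k \<in> K k \<and> (\<lambda>n. y (r n) k) \<longlonglongrightarrow> l k)"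
  using assms
proof (induction I)
  case empty
  show ?case
    by (auto intro: strict_mono_id)
next
  case (insert k I)
  then obtain l r where r: "strict_mono r" "\<forall>j\<in>I. l j \<in> K j \<and> (\<lambda>n. y (r n) j) \<longlonglongrightarrow> l j"
    by auto
  obtain c s where s: "c \<in> K k" "strict_mono s" "((\<lambda>n. y (r n) k) \<circ> s) \<longlonglongrightarrow> c"
    using insert.prems compact_imp_seq_compact unfolding seq_compact_def
    by (metis insertI1)
  have "(\<lambda>n. y (r (s n)) j) \<longlonglongrightarrow> l j" if "j \<in> I" for j
    using LIMSEQ_subseq_LIMSEQ[OF _ s(2), of "\<lambda>n. y (r n) j"] r(2) that by (auto simp: o_def)
  then have "\<forall>j\<in>insert k I. (l(k := c)) j \<in> K j \<and> (\<lambda>n. y ((r \<circ> s) n) j) \<longlonglongrightarrow> (l(k := c)) j"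
    using r(2) s insert.hyps by (auto simp: o_def)
  with strict_mono_o[OF r(1) s(2)] show ?case
    by blast
qed

lemma tendsto_if_subsequences_tendsto:
  fixes u :: "nat \<Rightarrow> 'a :: metric_space"
  assumes "\<And>r :: nat \<Rightarrow> nat. strict_mono r \<Longrightarrow> \<exists>s :: nat \<Rightarrow> nat. strict_mono s \<and> (\<lambda>n. u (r (s n))) \<longlonglongrightarrow> l"
  shows "u \<longlonglongrightarrow> l"
proof (rule ccontr)
  assume "\<not> u \<longlonglongrightarrow> l"
  then obtain e where e: "e > 0" "\<not> (\<forall>\<^sub>F n in sequentially. dist (u n) l < e)"
    unfolding tendsto_iff by blast
  then have "infinite {n. \<not> dist (u n) l < e}"
    by (simp only: cofinite_eq_sequentially[symmetric] eventually_cofinite simp_thms)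
  then obtain r :: "nat \<Rightarrow> nat" where r: "strict_mono r" "\<forall>n. \<not> dist (u (r n)) l < e"
    using infinite_enumerate[of "{n. \<not> dist (u n) l < e}"] by auto
  obtain s :: "nat \<Rightarrow> nat" where "(\<lambda>n. u (r (s n))) \<longlonglongrightarrow> l"
    using assms[OF r(1)] by blast
  then have "\<forall>\<^sub>F n in sequentially. dist (u (r (s n))) l < e"
    using e(1) by (simp add: tendsto_iff)
  then show False
    using r(2) by (auto simp: eventually_sequentially)
qed

lemma tendsto_linear:
  fixes g :: "'a :: euclidean_space \<Rightarrow> 'b :: real_normed_vector"
  assumes "linear g" and "(w \<longlongrightarrow> l) F"
  shows "((\<lambda>n. g (w n)) \<longlongrightarrow> g l) F"
proof -
  have "bounded_linear g"
    using assms(1) by (simp add: linear_conv_bounded_linear)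
  then show ?thesis
    using assms(2) by (rule bounded_linear.tendsto)
qed

lemma tendsto_0_if_norm_square_le:
  fixes w :: "nat \<Rightarrow> 'a :: real_normed_vector"
  assumes "\<And>i. (norm (w i))\<^sup>2 \<le> v i" and "v \<longlonglongrightarrow> 0"
  shows "w \<longlonglongrightarrow> 0"
proof (rule Lim_null_comparison)
  show "\<forall>\<^sub>F i in sequentially. norm (w i) \<le> sqrt (v i)"
    using assms(1) by (simp add: real_le_rsqrt)
  show "(\<lambda>i. sqrt (v i)) \<longlonglongrightarrow> 0"
    using tendsto_real_sqrt[OF assms(2)] by simp
qed

text \<open>
  The alternating direction method of multipliers for the problem of minimizing the sum of \<open>f k (u k)\<close>
  over \<open>u k \<in> Y k\<close> and \<open>w\<close> subject to the consensus constraints \<open>B k (u k) = R k w\<close>. For each agent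
  \<open>k\<close>, \<open>R k\<close> selects the part of the consensus variable that concerns it. The condition \<open>d_orth\<close> stands
  for the update of \<open>z\<close>: with \<open>d_step\<close> it says that the residuals of the constraints at step \<open>Suc i\<close> are
  orthogonal to the vectors \<open>(R k w)\<^sub>k\<close>, hence that \<open>z (Suc i)\<close> is the least squares fit to the agents'
  values; and it says that the multipliers are dual feasible, as the consensus variable has no cost.
\<close>

locale consensus_admm =
  fixes I :: "'k set" and Y :: "'k \<Rightarrow> 'a :: euclidean_space set" and f :: "'k \<Rightarrow> 'a \<Rightarrow> real"
    and B :: "'k \<Rightarrow> 'a \<Rightarrow> 'b :: euclidean_space" and R :: "'k \<Rightarrow> 'b \<Rightarrow> 'b"
    and \<kappa> :: real and y :: "nat \<Rightarrow> 'k \<Rightarrow> 'a" and z :: "nat \<Rightarrow> 'b" and d :: "nat \<Rightarrow> 'k \<Rightarrow> 'b"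
  assumes finite_I: "finite I"
    and compact_Y: "\<And>k. k \<in> I \<Longrightarrow> compact (Y k)"
    and convex_f: "\<And>k. k \<in> I \<Longrightarrow> convex_on (Y k) (f k)"
    and cont_f: "\<And>k. k \<in> I \<Longrightarrow> continuous_on (Y k) (f k)"
    and linear_B: "\<And>k. k \<in> I \<Longrightarrow> linear (B k)"
    and linear_R: "\<And>k. k \<in> I \<Longrightarrow> linear (R k)"
    and kappa_pos: "0 < \<kappa>"
    and y_in: "\<And>i k. k \<in> I \<Longrightarrow> y (Suc i) k \<in> Y k"
    and y_min: "\<And>i k u. k \<in> I \<Longrightarrow> u \<in> Y k \<Longrightarrow>
        f k (y (Suc i) k) + d i k \<bullet> B k (y (Suc i) k) + \<kappa> / 2 * (norm (B k (y (Suc i) k) - R k (z i)))\<^sup>2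
        \<le> f k u + d i k \<bullet> B k u + \<kappa> / 2 * (norm (B k u - R k (z i)))\<^sup>2"
    and d_step: "\<And>i k. k \<in> I \<Longrightarrow> d (Suc i) k = d i k + \<kappa> *\<^sub>R (B k (y (Suc i) k) - R k (z (Suc i)))"
    and d_orth: "\<And>i w. (\<Sum>k\<in>I. d i k \<bullet> R k w) = 0"
    and z_bounded: "bounded (range z)"
begin

definition saddle :: "('k \<Rightarrow> 'a) \<Rightarrow> 'b \<Rightarrow> ('k \<Rightarrow> 'b) \<Rightarrow> bool" where
  "saddle y' z' d' \<longleftrightarrow> (\<forall>w. (\<Sum>k\<in>I. d' k \<bullet> R k w) = 0) \<and>
     (\<forall>k\<in>I. y' k \<in> Y k \<and> B k (y' k) = R k z' \<and>
        (\<forall>u\<in>Y k. f k (y' k) + d' k \<bullet> B k (y' k) \<le> f k u + d' k \<bullet> B k u))"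

text \<open>
  The squared distance of the pair of multipliers and consensus variable from a saddle point, in a norm
  that balances the two with the penalty parameter.
\<close>

definition energy :: "'b \<Rightarrow> ('k \<Rightarrow> 'b) \<Rightarrow> nat \<Rightarrow> real" where
  "energy z' d' i = (\<Sum>k\<in>I. (norm (d i k - d' k))\<^sup>2 / \<kappa> + \<kappa> * (norm (R k (z i - z')))\<^sup>2)"

definition progress :: "nat \<Rightarrow> real" where
  "progress i = (\<Sum>k\<in>I. (norm (d (Suc i) k - d i k))\<^sup>2 / \<kappa> + \<kappa> * (norm (R k (z (Suc i) - z i)))\<^sup>2)"

text \<open>
  The agent minimizes a perturbed Lagrangian: its multiplier differs from the one after the update by \<open>\<kappa>\<close>
  times the last move of the consensus variable.
\<close>

lemma y_variational:
  assumes "k \<in> I" "u \<in> Y k"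
  shows "f k (y (Suc i) k) + (d (Suc i) k + \<kappa> *\<^sub>R R k (z (Suc i) - z i)) \<bullet> B k (y (Suc i) k)
       \<le> f k u + (d (Suc i) k + \<kappa> *\<^sub>R R k (z (Suc i) - z i)) \<bullet> B k u"
proof -
  have eq: "d (Suc i) k + \<kappa> *\<^sub>R R k (z (Suc i) - z i) = d i k + \<kappa> *\<^sub>R (B k (y (Suc i) k) - R k (z i))"
    using d_step[OF assms(1), of i] linear_R[OF assms(1)] by (simp add: linear_diff algebra_simps)
  show ?thesis
    unfolding eq
    by (rule convex_quadratic_min_variational[OF convex_f linear_B y_in assms(2) _ y_min])
       (use assms(1) kappa_pos in auto)
qed

text \<open>
  The variational inequality at the point \<open>y'\<close> and the saddle point inequality at the new iterate are
  added and summed over the agents. Since \<open>d (Suc i) - d i\<close> is \<open>\<kappa>\<close> times the residual and all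
  multipliers are orthogonal to the vectors \<open>(R k w)\<^sub>k\<close>, what remains is that the scalar product of the
  displacement from the saddle point with the last move is not positive. By the cosine law this is the
  claim.
\<close>

lemma energy_decrease:
  assumes "saddle y' z' d'"
  shows "energy z' d' (Suc i) + progress i \<le> energy z' d' i"
proof -
  define dd where "dd k = d (Suc i) k - d i k" for k
  define zz where "zz = z (Suc i) - z i"
  define e where "e k = d (Suc i) k - d' k" for k
  define x where "x = z (Suc i) - z'"
  have orth: "(\<Sum>k\<in>I. e k \<bullet> R k w) = 0" "(\<Sum>k\<in>I. dd k \<bullet> R k w) = 0" for w
    using d_orth assms by (simp_all add: e_def dd_def saddle_def inner_diff_left sum_subtractf)
  have "\<kappa> * (e k \<bullet> R k x) + e k \<bullet> dd k + \<kappa> * (\<kappa> * (R k zz \<bullet> R k x)) + \<kappa> * (dd k \<bullet> R k zz) \<le> 0" if k: "k \<in> I" for k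
  proof -
    have y': "y' k \<in> Y k" "B k (y' k) = R k z'"
      "f k (y' k) + d' k \<bullet> B k (y' k) \<le> f k (y (Suc i) k) + d' k \<bullet> B k (y (Suc i) k)"
      using assms k y_in by (auto simp: saddle_def)
    have B: "B k (y (Suc i) k) = R k z' + R k x + (1 / \<kappa>) *\<^sub>R dd k"
      using d_step[OF k, of i] linear_R[OF k] kappa_pos by (simp add: dd_def x_def linear_diff)
    have "(e k + \<kappa> *\<^sub>R R k zz) \<bullet> (R k x + (1 / \<kappa>) *\<^sub>R dd k) \<le> 0"
      using y_variational[OF k y'(1), of i] y'(3)
      by (simp add: y'(2) B inner_add_left inner_add_right e_def zz_def inner_diff_left algebra_simps)
    then have "\<kappa> * ((e k + \<kappa> *\<^sub>R R k zz) \<bullet> (R k x + (1 / \<kappa>) *\<^sub>R dd k)) \<le> 0"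
      using kappa_pos by (simp add: mult_le_0_iff)
    then show ?thesis
      using kappa_pos by (simp add: inner_add_left inner_add_right algebra_simps inner_commute)
  qed
  then have "(\<Sum>k\<in>I. \<kappa> * (e k \<bullet> R k x) + e k \<bullet> dd k + \<kappa> * (\<kappa> * (R k zz \<bullet> R k x)) + \<kappa> * (dd k \<bullet> R k zz)) \<le> 0"
    by (rule sum_nonpos)
  then have main: "(\<Sum>k\<in>I. e k \<bullet> dd k + \<kappa> * (\<kappa> * (R k zz \<bullet> R k x))) \<le> 0"
    by (simp add: sum.distrib orth flip: sum_distrib_left)
  have "energy z' d' i = (\<Sum>k\<in>I. (norm (e k - dd k))\<^sup>2 / \<kappa> + \<kappa> * (norm (R k x - R k zz))\<^sup>2)"
    unfolding energy_def e_def dd_def x_def zz_def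
    by (intro sum.cong refl arg_cong2[where f="(+)"] arg_cong2[where f="(*)"] arg_cong2[where f="(/)"]
          arg_cong2[where f=power] arg_cong[where f=norm])
       (simp_all add: linear_diff[OF linear_R])
  also have "\<dots> = (\<Sum>k\<in>I. ((norm (e k))\<^sup>2 / \<kappa> + \<kappa> * (norm (R k x))\<^sup>2) + ((norm (dd k))\<^sup>2 / \<kappa> + \<kappa> * (norm (R k zz))\<^sup>2)
       - (2 / \<kappa>) * (e k \<bullet> dd k + \<kappa> * (\<kappa> * (R k zz \<bullet> R k x))))"
    using kappa_pos by (intro sum.cong refl)
      (simp add: power2_norm_eq_inner inner_diff_left inner_diff_right inner_commute field_simps)
  also have "\<dots> = energy z' d' (Suc i) + progress i
       - (2 / \<kappa>) * (\<Sum>k\<in>I. e k \<bullet> dd k + \<kappa> * (\<kappa> * (R k zz \<bullet> R k x)))"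
    by (simp only: energy_def progress_def e_def dd_def x_def zz_def sum.distrib[symmetric]
          sum_subtractf[symmetric] sum_distrib_left)
  finally show ?thesis
    using mult_nonneg_nonpos[OF _ main, of "2 / \<kappa>"] kappa_pos by simp
qed

lemma energy_nonneg: "0 \<le> energy z' d' i"
  unfolding energy_def using kappa_pos by (intro sum_nonneg add_nonneg_nonneg) auto

lemma progress_nonneg: "0 \<le> progress i"
  unfolding progress_def using kappa_pos by (intro sum_nonneg add_nonneg_nonneg) auto

lemma d_dist_le_energy: "k \<in> I \<Longrightarrow> (norm (d i k - d' k))\<^sup>2 \<le> \<kappa> * energy z' d' i"
proof -
  assume k: "k \<in> I"
  have "(norm (d i k - d' k))\<^sup>2 / \<kappa> \<le> (norm (d i k - d' k))\<^sup>2 / \<kappa> + \<kappa> * (norm (R k (z i - z')))\<^sup>2"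
    using kappa_pos by simp
  also have "\<dots> \<le> energy z' d' i"
    unfolding energy_def using kappa_pos
    by (intro member_le_sum[OF k _ finite_I]) (auto intro!: add_nonneg_nonneg)
  finally show ?thesis
    using kappa_pos by (simp add: field_simps)
qed

lemma d_change_le_progress: "k \<in> I \<Longrightarrow> (norm (d (Suc i) k - d i k))\<^sup>2 \<le> \<kappa> * progress i"
  and R_change_le_progress: "k \<in> I \<Longrightarrow> \<kappa> * (norm (R k (z (Suc i) - z i)))\<^sup>2 \<le> progress i"
proof -
  assume k: "k \<in> I"
  have *: "(norm (d (Suc i) k - d i k))\<^sup>2 / \<kappa> + \<kappa> * (norm (R k (z (Suc i) - z i)))\<^sup>2 \<le> progress i"
    unfolding progress_def using kappa_pos
    by (intro member_le_sum[OF k _ finite_I]) (auto intro!: add_nonneg_nonneg)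
  have "0 \<le> \<kappa> * (norm (R k (z (Suc i) - z i)))\<^sup>2"
    using kappa_pos by simp
  with * have "(norm (d (Suc i) k - d i k))\<^sup>2 / \<kappa> \<le> progress i"
    by linarith
  then show "(norm (d (Suc i) k - d i k))\<^sup>2 \<le> \<kappa> * progress i"
    using kappa_pos by (simp add: field_simps)
  have "0 \<le> (norm (d (Suc i) k - d i k))\<^sup>2 / \<kappa>"
    using kappa_pos by simp
  with * show "\<kappa> * (norm (R k (z (Suc i) - z i)))\<^sup>2 \<le> progress i"
    by linarith
qed

lemma energy_antimono:
  assumes "saddle y' z' d'"
  shows "decseq (energy z' d')"
proof (rule decseq_SucI)
  show "energy z' d' (Suc i) \<le> energy z' d' i" for i
    using energy_decrease[OF assms, of i] progress_nonneg[of i] by linarith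
qed

lemma progress_tendsto_0:
  assumes "saddle y' z' d'"
  shows "progress \<longlonglongrightarrow> 0"
proof -
  obtain L where L: "energy z' d' \<longlonglongrightarrow> L"
    using energy_nonneg by (auto intro: decseq_convergent[OF energy_antimono[OF assms], of 0])
  have "(\<lambda>i. energy z' d' i - energy z' d' (Suc i)) \<longlonglongrightarrow> L - L"
    by (intro tendsto_diff L LIMSEQ_Suc)
  moreover have "progress i \<le> energy z' d' i - energy z' d' (Suc i)" for i
    using energy_decrease[OF assms, of i] by linarith
  ultimately show ?thesis
    using progress_nonneg
    by (intro Lim_null_comparison[of progress "\<lambda>i. energy z' d' i - energy z' d' (Suc i)"]) auto
qed

lemma changes_tendsto_0:
  assumes "saddle y' z' d'" and k: "k \<in> I"
  shows "(\<lambda>i. d (Suc i) k - d i k) \<longlonglongrightarrow> 0" and "(\<lambda>i. R k (z (Suc i) - z i)) \<longlonglongrightarrow> 0"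
proof -
  have "(\<lambda>i. \<kappa> * progress i) \<longlonglongrightarrow> 0"
    using tendsto_mult_right_zero[OF progress_tendsto_0[OF assms(1)]] .
  with d_change_le_progress[OF k] show "(\<lambda>i. d (Suc i) k - d i k) \<longlonglongrightarrow> 0"
    by (rule tendsto_0_if_norm_square_le)
  have "(\<lambda>i. (1 / \<kappa>) * progress i) \<longlonglongrightarrow> 0"
    using tendsto_mult_right_zero[OF progress_tendsto_0[OF assms(1)]] .
  moreover have "(norm (R k (z (Suc i) - z i)))\<^sup>2 \<le> (1 / \<kappa>) * progress i" for i
    using R_change_le_progress[OF k, of i] kappa_pos by (simp add: field_simps)
  ultimately show "(\<lambda>i. R k (z (Suc i) - z i)) \<longlonglongrightarrow> 0"
    by (rule tendsto_0_if_norm_square_le[rotated])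
qed

text \<open>
  The multipliers stay in a ball because the energy does not increase, the other variables are bounded
  by assumption, so there are limit points. As the moves tend to zero, the residuals vanish in the limit,
  and so does the perturbation in the variational inequality.
\<close>

lemma saddle_limit_point:
  fixes r :: "nat \<Rightarrow> nat"
  assumes "saddle y' z' d'" and r: "strict_mono r"
  shows "\<exists>(s :: nat \<Rightarrow> nat) yl zl dl. strict_mono s \<and> saddle yl zl dl \<and>
    (\<forall>k\<in>I. (\<lambda>n. y (Suc (r (s n))) k) \<longlonglongrightarrow> yl k \<and> (\<lambda>n. d (Suc (r (s n))) k) \<longlonglongrightarrow> dl k) \<and>
    (\<lambda>n. z (Suc (r (s n)))) \<longlonglongrightarrow> zl"
proof -
  define E where "E = sqrt (\<kappa> * energy z' d' 0)"
  have d_in: "d i k \<in> cball (d' k) E" if "k \<in> I" for i k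
  proof -
    have "(norm (d i k - d' k))\<^sup>2 \<le> \<kappa> * energy z' d' i"
      using d_dist_le_energy[OF that] .
    also have "\<dots> \<le> \<kappa> * energy z' d' 0"
      using kappa_pos energy_antimono[OF assms(1)] by (simp add: decseqD)
    finally show ?thesis
      by (simp add: E_def real_le_rsqrt dist_norm norm_minus_commute)
  qed
  obtain yl s1 where s1: "strict_mono s1"
    "\<forall>k\<in>I. yl k \<in> Y k \<and> (\<lambda>n. y (Suc (r (s1 n))) k) \<longlonglongrightarrow> yl k"
    using convergent_subsequences_finite_family[where I = I and K = Y and y = "\<lambda>n. y (Suc (r n))"]
      finite_I compact_Y y_in by auto
  have "\<exists>l q. strict_mono q \<and> (\<forall>k\<in>I. l k \<in> cball (d' k) E \<and> (\<lambda>n. d (Suc (r (s1 (q n)))) k) \<longlonglongrightarrow> l k)"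
    using finite_I d_in
    by (intro convergent_subsequences_finite_family[where y = "\<lambda>n. d (Suc (r (s1 n)))"]) auto
  then obtain dl s2 where s2: "strict_mono s2"
    "\<forall>k\<in>I. (\<lambda>n. d (Suc (r (s1 (s2 n)))) k) \<longlonglongrightarrow> dl k"
    by blast
  have "seq_compact (closure (range z))"
    using z_bounded by (simp add: compact_closure compact_imp_seq_compact)
  moreover have "\<forall>n. z (Suc (r (s1 (s2 n)))) \<in> closure (range z)"
    using closure_subset[of "range z"] by auto
  ultimately obtain zl s3 where s3: "strict_mono s3" "((\<lambda>n. z (Suc (r (s1 (s2 n))))) \<circ> s3) \<longlonglongrightarrow> zl"
    by (rule seq_compactE)
  define s where "s = s1 \<circ> s2 \<circ> s3"
  have s: "strict_mono s"
    unfolding s_def using s1 s2 s3 by (intro strict_mono_o)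
  have y_lim: "(\<lambda>n. y (Suc (r (s n))) k) \<longlonglongrightarrow> yl k" if "k \<in> I" for k
    using LIMSEQ_subseq_LIMSEQ[OF _ strict_mono_o[OF s2(1) s3(1)], of "\<lambda>n. y (Suc (r (s1 n))) k" "yl k"] s1(2) that
    by (simp add: o_def s_def)
  have d_lim: "(\<lambda>n. d (Suc (r (s n))) k) \<longlonglongrightarrow> dl k" if "k \<in> I" for k
    using LIMSEQ_subseq_LIMSEQ[OF _ s3(1), of "\<lambda>n. d (Suc (r (s1 (s2 n)))) k" "dl k"] s2(2) that
    by (simp add: o_def s_def)
  have z_lim: "(\<lambda>n. z (Suc (r (s n)))) \<longlonglongrightarrow> zl"
    using s3(2) by (simp add: o_def s_def)
  have rs: "strict_mono (r \<circ> s)"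
    using r s by (rule strict_mono_o)
  have B_lim: "(\<lambda>n. B k (y (Suc (r (s n))) k)) \<longlonglongrightarrow> B k (yl k)" if "k \<in> I" for k
    using linear_B[OF that] y_lim[OF that] by (rule tendsto_linear)
  have R_lim: "(\<lambda>n. R k (z (Suc (r (s n))))) \<longlonglongrightarrow> R k zl" if "k \<in> I" for k
    using linear_R[OF that] z_lim by (rule tendsto_linear)
  have along: "(\<lambda>n. w (r (s n))) \<longlonglongrightarrow> l" if "w \<longlonglongrightarrow> l" for w :: "nat \<Rightarrow> 'b" and l
    using LIMSEQ_subseq_LIMSEQ[OF that rs] by (simp add: o_def)
  have "saddle yl zl dl"
    unfolding saddle_def
  proof (intro conjI allI ballI)
    fix w
    have "(\<lambda>n. \<Sum>k\<in>I. d (Suc (r (s n))) k \<bullet> R k w) \<longlonglongrightarrow> (\<Sum>k\<in>I. dl k \<bullet> R k w)"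
      by (intro tendsto_intros d_lim)
    then show "(\<Sum>k\<in>I. dl k \<bullet> R k w) = 0"
      by (simp add: d_orth LIMSEQ_const_iff)
  next
    fix k
    assume k: "k \<in> I"
    show "yl k \<in> Y k"
      using s1(2)[rule_format, OF k] by simp
    have "(\<lambda>n. (1 / \<kappa>) *\<^sub>R (d (Suc (r (s n))) k - d (r (s n)) k)) \<longlonglongrightarrow> (1 / \<kappa>) *\<^sub>R 0"
      by (intro tendsto_intros along changes_tendsto_0[OF assms(1) k])
    moreover have "(1 / \<kappa>) *\<^sub>R (d (Suc i) k - d i k) = B k (y (Suc i) k) - R k (z (Suc i))" for i
      using d_step[OF k, of i] kappa_pos by simp
    ultimately have "(\<lambda>n. B k (y (Suc (r (s n))) k) - R k (z (Suc (r (s n))))) \<longlonglongrightarrow> 0"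
      by simp
    moreover have "(\<lambda>n. B k (y (Suc (r (s n))) k) - R k (z (Suc (r (s n))))) \<longlonglongrightarrow> B k (yl k) - R k zl"
      by (intro tendsto_diff B_lim R_lim k)
    ultimately show "B k (yl k) = R k zl"
      using LIMSEQ_unique by fastforce
    fix u
    assume u: "u \<in> Y k"
    have f_lim: "(\<lambda>n. f k (y (Suc (r (s n))) k)) \<longlonglongrightarrow> f k (yl k)"
      using continuous_on_tendsto_compose[OF cont_f[OF k] y_lim[OF k]] s1(2)[rule_format, OF k] y_in[OF k] by simp
    let ?g = "\<lambda>n. d (Suc (r (s n))) k + \<kappa> *\<^sub>R R k (z (Suc (r (s n))) - z (r (s n)))"
    have g_lim: "?g \<longlonglongrightarrow> dl k + \<kappa> *\<^sub>R 0"
      by (intro tendsto_intros along changes_tendsto_0[OF assms(1) k] d_lim k)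
    have "f k (yl k) + (dl k + \<kappa> *\<^sub>R 0) \<bullet> B k (yl k) \<le> f k u + (dl k + \<kappa> *\<^sub>R 0) \<bullet> B k u"
    proof (rule LIMSEQ_le)
      show "(\<lambda>n. f k (y (Suc (r (s n))) k) + ?g n \<bullet> B k (y (Suc (r (s n))) k))
              \<longlonglongrightarrow> f k (yl k) + (dl k + \<kappa> *\<^sub>R 0) \<bullet> B k (yl k)"
        by (intro tendsto_intros f_lim g_lim B_lim k)
      show "(\<lambda>n. f k u + ?g n \<bullet> B k u) \<longlonglongrightarrow> f k u + (dl k + \<kappa> *\<^sub>R 0) \<bullet> B k u"
        by (intro tendsto_intros g_lim)
      show "\<exists>N. \<forall>n\<ge>N. f k (y (Suc (r (s n))) k) + ?g n \<bullet> B k (y (Suc (r (s n))) k) \<le> f k u + ?g n \<bullet> B k u"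
        using y_variational[OF k u] by blast
    qed
    then show "f k (yl k) + dl k \<bullet> B k (yl k) \<le> f k u + dl k \<bullet> B k u"
      by simp
  qed
  then show ?thesis
    using s y_lim d_lim z_lim by blast
qed

text \<open>
  At points that satisfy the consensus constraints the multipliers contribute nothing to the Lagrangian.
\<close>

lemma saddle_optimal:
  assumes "saddle y' z' d'"
    and "\<And>k. k \<in> I \<Longrightarrow> u k \<in> Y k" and "\<And>k. k \<in> I \<Longrightarrow> B k (u k) = R k w"
  shows "(\<Sum>k\<in>I. f k (y' k)) \<le> (\<Sum>k\<in>I. f k (u k))"
proof -
  have "(\<Sum>k\<in>I. f k (y' k) + d' k \<bullet> R k z') \<le> (\<Sum>k\<in>I. f k (u k) + d' k \<bullet> R k w)"
  proof (rule sum_mono)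
    fix k
    assume k: "k \<in> I"
    then have "B k (y' k) = R k z'" "f k (y' k) + d' k \<bullet> B k (y' k) \<le> f k (u k) + d' k \<bullet> B k (u k)"
      using assms(1,2) by (auto simp: saddle_def)
    then show "f k (y' k) + d' k \<bullet> R k z' \<le> f k (u k) + d' k \<bullet> R k w"
      using assms(3)[OF k] by simp
  qed
  then show ?thesis
    using assms(1) by (simp add: saddle_def sum.distrib)
qed

text \<open>
  Every limit point is a saddle point, so that its primal part is the unique minimizer. The energy with
  respect to such a limit point is decreasing and tends to zero along a subsequence, hence tends to zero:
  there is only one limit point of the multipliers.
\<close>

theorem convergence:
  assumes opt: "saddle y' z' d'"
    and unique: "\<And>u w. (\<And>k. k \<in> I \<Longrightarrow> u k \<in> Y k \<and> B k (u k) = R k w) \<Longrightarrow>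
        (\<Sum>k\<in>I. f k (u k)) \<le> (\<Sum>k\<in>I. f k (y' k)) \<Longrightarrow> \<forall>k\<in>I. u k = y' k"
    and k: "k \<in> I"
  shows "(\<lambda>i. y i k) \<longlonglongrightarrow> y' k" and "convergent (\<lambda>i. d i k)"
proof -
  have limit_is_opt: "yl k = y' k" if "saddle yl zl dl" for yl zl dl
  proof -
    have "(\<Sum>k\<in>I. f k (yl k)) \<le> (\<Sum>k\<in>I. f k (y' k))"
      using opt by (intro saddle_optimal[OF that, of y' z']) (auto simp: saddle_def)
    then have "\<forall>k\<in>I. yl k = y' k"
      using that by (intro unique[of yl zl]) (auto simp: saddle_def)
    with k show ?thesis
      by blast
  qed
  have "(\<lambda>i. y (Suc i) k) \<longlonglongrightarrow> y' k"
  proof (rule tendsto_if_subsequences_tendsto)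
    fix r :: "nat \<Rightarrow> nat"
    assume "strict_mono r"
    from saddle_limit_point[OF opt this] obtain s yl zl dl
      where *: "strict_mono s" "saddle yl zl dl" "\<forall>k\<in>I. (\<lambda>n. y (Suc (r (s n))) k) \<longlonglongrightarrow> yl k"
      by blast
    then have "(\<lambda>n. y (Suc (r (s n))) k) \<longlonglongrightarrow> y' k"
      using k limit_is_opt by force
    with *(1) show "\<exists>s :: nat \<Rightarrow> nat. strict_mono s \<and> (\<lambda>n. y (Suc (r (s n))) k) \<longlonglongrightarrow> y' k"
      by blast
  qed
  then show "(\<lambda>i. y i k) \<longlonglongrightarrow> y' k"
    by (rule LIMSEQ_imp_Suc)
  obtain s :: "nat \<Rightarrow> nat" and yl zl dl where lim: "strict_mono s" "saddle yl zl dl" "(\<lambda>n. z (Suc (s n))) \<longlonglongrightarrow> zl"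
    "\<forall>k\<in>I. (\<lambda>n. d (Suc (s n)) k) \<longlonglongrightarrow> dl k"
    using saddle_limit_point[OF opt, of "\<lambda>n. n"] by (auto simp: strict_mono_def)
  obtain L where L: "energy zl dl \<longlonglongrightarrow> L"
    using energy_nonneg by (auto intro: decseq_convergent[OF energy_antimono[OF lim(2)], of 0])
  have "strict_mono (Suc \<circ> s)"
    using lim(1) by (auto simp: strict_mono_def)
  then have "(\<lambda>n. energy zl dl (Suc (s n))) \<longlonglongrightarrow> L"
    using LIMSEQ_subseq_LIMSEQ[OF L] by (simp add: o_def)
  moreover have "(\<lambda>n. energy zl dl (Suc (s n))) \<longlonglongrightarrow> (\<Sum>k\<in>I. (norm (dl k - dl k))\<^sup>2 / \<kappa> + \<kappa> * (norm (0 :: 'b))\<^sup>2)"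
    unfolding energy_def
  proof (intro tendsto_intros lim(4)[rule_format])
    fix j
    assume j: "j \<in> I"
    have "(\<lambda>n. R j (z (Suc (s n)) - zl)) \<longlonglongrightarrow> R j (zl - zl)"
      by (intro tendsto_linear[OF linear_R[OF j]] tendsto_diff lim(3) tendsto_const)
    then show "(\<lambda>n. R j (z (Suc (s n)) - zl)) \<longlonglongrightarrow> 0"
      using linear_0[OF linear_R[OF j]] by simp
  qed (use kappa_pos in auto)
  ultimately have "L = 0"
    using LIMSEQ_unique by fastforce
  then have "(\<lambda>i. \<kappa> * energy zl dl i) \<longlonglongrightarrow> 0"
    using tendsto_mult_right_zero[OF L[unfolded \<open>L = 0\<close>]] by simp
  then have "(\<lambda>i. d i k - dl k) \<longlonglongrightarrow> 0"
    by (rule tendsto_0_if_norm_square_le[OF d_dist_le_energy[OF k]])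
  then show "convergent (\<lambda>i. d i k)"
    by (metis LIM_zero_cancel convergentI)
qed

end

section \<open>Feasible sets\<close>

lemma on_lines_nth [simp]: "on_lines B \<xi> $ e = (if e \<in> B then \<xi> $ e else 0)"
  by (simp add: on_lines_def)

lemma on_nodes_nth [simp]: "on_nodes V \<sigma> $ n = (if n \<in> V then \<sigma> $ n else 0)"
  by (simp add: on_nodes_def)

lemma linear_on_lines: "linear (on_lines B)"
  by (rule linearI) (auto simp: vec_eq_iff)

lemma on_lines_on_lines [simp]: "on_lines B (on_lines C u) = on_lines (B \<inter> C) u"
  by (auto simp: vec_eq_iff)

lemma inner_on_lines: "u \<bullet> on_lines B w = (\<Sum>e\<in>B. u $ e \<bullet> w $ e)"
proof -
  have "u \<bullet> on_lines B w = (\<Sum>e\<in>UNIV. if e \<in> B then u $ e \<bullet> w $ e else 0)"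
    unfolding inner_vec_def by (intro sum.cong) auto
  also have "\<dots> = (\<Sum>e\<in>B. u $ e \<bullet> w $ e)"
    by (simp add: sum.If_cases)
  finally show ?thesis .
qed

lemma inner_on_lines_commute: "on_lines B u \<bullet> w = u \<bullet> on_lines B w"
  unfolding inner_commute[of "on_lines B u" w] inner_on_lines by (simp add: inner_commute)

lemma on_lines_UNION:
  assumes "finite J" "disjoint_family_on C J"
  shows "on_lines (\<Union>j\<in>J. C j) u = (\<Sum>j\<in>J. on_lines (C j) u)"
proof -
  have "(\<Sum>j\<in>J. on_lines (C j) u $ e) = (if e \<in> (\<Union>j\<in>J. C j) then u $ e else 0)" for e
  proof (cases "e \<in> (\<Union>j\<in>J. C j)")
    case True
    then obtain i where i: "i \<in> J" "e \<in> C i"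
      by blast
    have "(\<Sum>j\<in>J. on_lines (C j) u $ e) = (\<Sum>j\<in>J. if j = i then u $ e else 0)"
      using i assms(2) by (intro sum.cong) (auto simp: disjoint_family_on_def)
    then show ?thesis
      using i assms(1) True by simp
  qed (simp add: sum.neutral)
  then show ?thesis
    by (intro vec_eq_iff[THEN iffD2] allI) (simp add: sum_component)
qed

lemma current_space_on_lines: "\<xi> \<in> current_space g B \<Longrightarrow> on_lines B \<xi> = \<xi>"
  unfolding vec_eq_iff[of "on_lines B \<xi>"] by (auto simp: current_space_def vec_eq_iff)

text \<open>
  The orthogonal projection onto \<open>current_space g B\<close> times \<open>dg_space g V\<close>. Composed with it, a cost that
  is convex on that subspace becomes a convex function on the whole space.
\<close>

definition restr :: "('n :: finite) microgrid \<Rightarrow> 'n set \<Rightarrow> ('n \<times> 'n) set \<Rightarrow>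
    'n currents \<times> 'n dg_powers \<Rightarrow> 'n currents \<times> 'n dg_powers" where
  "restr g V B p =
     ((\<chi> e q. if e \<in> B \<and> snd q \<in> line_phases g e then fst p $ e $ q else 0),
      (\<chi> n \<phi>. if n \<in> V \<and> (\<phi>, n) \<in> dg_units g then snd p $ n $ \<phi> else 0))"

lemma linear_restr: "linear (restr g V B)"
  by (rule linearI) (auto simp: restr_def vec_eq_iff)

lemma restr_restr: "restr g V B (restr g V' B' p) = restr g (V \<inter> V') (B \<inter> B') p"
  by (auto simp: restr_def vec_eq_iff)

lemma restr_eq_iff: "restr g V B p = p \<longleftrightarrow> fst p \<in> current_space g B \<and> snd p \<in> dg_space g V"
  unfolding restr_def current_space_def dg_space_def prod_eq_iff vec_eq_iff
  by (auto simp: split_paired_all)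

lemma restr_in_space: "fst (restr g V B p) \<in> current_space g B" "snd (restr g V B p) \<in> dg_space g V"
  by (auto simp: restr_def current_space_def dg_space_def)

lemma restr_on_lines:
  assumes "fst p \<in> current_space g B'" "snd p \<in> dg_space g V'" "B \<subseteq> B'" "V \<subseteq> V'"
  shows "restr g V B p = (on_lines B (fst p), on_nodes V (snd p))"
proof -
  have "fst p $ e $ q = 0" if "e \<in> B" "snd q \<notin> line_phases g e" for e q
    using assms(1) that by (cases q, cases e) (auto simp: current_space_def)
  moreover have "snd p $ n $ \<phi> = 0" if "n \<in> V" "(\<phi>, n) \<notin> dg_units g" for n \<phi>
    using assms(2) that by (auto simp: dg_space_def)
  ultimately show ?thesis
    by (auto simp: restr_def vec_eq_iff)
qed

lemma line_current_add: "line_current (u + w) e \<phi> = line_current u e \<phi> + line_current w e \<phi>"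
  and line_current_scaleR: "line_current (c *\<^sub>R u) e \<phi> = c *\<^sub>R line_current u e \<phi>"
  by (simp_all add: line_current_def complex_eq_iff)

lemma node_current_add: "node_current g (u + w) n \<phi> = node_current g u n \<phi> + node_current g w n \<phi>"
  by (simp add: node_current_def line_current_add sum.distrib)

lemma node_current_scaleR: "node_current g (c *\<^sub>R u) n \<phi> = c *\<^sub>R node_current g u n \<phi>"
  unfolding node_current_def line_current_scaleR scaleR_right_diff_distrib scaleR_sum_right ..

lemma linear_A_map: "linear (A_map g n \<phi>)"
  by (rule linearI) (simp_all add: A_map_def node_current_add node_current_scaleR vec_eq_iff forall_2)

lemma A_map_cong:
  assumes "\<And>k. (n, k) \<in> lines g \<Longrightarrow> u $ (n, k) = w $ (n, k)"
    and "\<And>k. (k, n) \<in> lines g \<Longrightarrow> u $ (k, n) = w $ (k, n)"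
  shows "A_map g n \<phi> u = A_map g n \<phi> w"
proof -
  have "node_current g u n \<phi> = node_current g w n \<phi>"
    unfolding node_current_def line_current_def
    by (intro arg_cong2[where f = minus] sum.cong) (auto simp: assms)
  then show ?thesis
    by (simp add: A_map_def)
qed

lemma within_caps_iff:
  "within_caps g B \<xi> \<longleftrightarrow> (\<forall>e\<in>B. \<forall>\<phi>\<in>line_phases g e. cmod (line_current \<xi> e \<phi>) \<le> \<bar>current_cap g e\<bar>)"
  unfolding within_caps_def M_bar_quadratic_form by (simp flip: abs_le_square_iff)

lemma strictly_within_caps_iff:
  "strictly_within_caps g B \<xi> \<longleftrightarrow> (\<forall>e\<in>B. \<forall>\<phi>\<in>line_phases g e. cmod (line_current \<xi> e \<phi>) < \<bar>current_cap g e\<bar>)"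
proof -
  have "(cmod w)\<^sup>2 < c\<^sup>2 \<longleftrightarrow> cmod w < \<bar>c\<bar>" for w c
    using abs_le_square_iff[of c "cmod w"] by (simp add: not_le[symmetric])
  then show ?thesis
    unfolding strictly_within_caps_def M_bar_quadratic_form by simp
qed

text \<open>
  The constraints are divided into the caps, for which Slater's condition provides an interior point, and
  the affine ones, which define a polyhedron. Neither part refers to the coordinates that \<open>restr\<close>
  deletes; thus the caps define a set that can have interior points in the whole space.
\<close>

definition cap_part :: "('n :: finite) microgrid \<Rightarrow> ('n \<times> 'n) set \<Rightarrow> ('n currents \<times> 'n dg_powers) set" where
  "cap_part g B = {p. within_caps g B (fst p)}"

definition affine_part :: "('n :: finite) microgrid \<Rightarrow> 'n set \<Rightarrow> ('n \<times> 'n) set \<Rightarrow>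
    ('n currents \<times> 'n dg_powers) set" where
  "affine_part g V B = {p. dg_boxes g V (snd (restr g V B p)) \<and>
     node_balances g V (fst (restr g V B p)) (snd (restr g V B p))}"

lemma within_caps_restr: "within_caps g B (fst (restr g V B p)) \<longleftrightarrow> within_caps g B (fst p)"
  unfolding within_caps_iff by (simp add: line_current_def restr_def)

lemma restr_feasible_iff: "restr g V B p \<in> feasible_on g V B \<longleftrightarrow> p \<in> cap_part g B \<inter> affine_part g V B"
  by (auto simp: feasible_on_def case_prod_beta restr_in_space cap_part_def affine_part_def within_caps_restr)

lemma feasible_on_iff: "p \<in> feasible_on g V B \<longleftrightarrow> restr g V B p = p \<and> p \<in> cap_part g B \<inter> affine_part g V B"
  by (metis (no_types, lifting) feasible_on_def case_prodD mem_Collect_eq prod.collapse restr_eq_iff restr_feasible_iff)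

lemma linear_line_current: "linear (\<lambda>p :: 'n :: finite currents \<times> 'n dg_powers. line_current (fst p) e \<phi>)"
  by (rule linearI) (simp_all add: line_current_add line_current_scaleR)

lemma convex_cap_part: "convex (cap_part g B)"
proof -
  have "cap_part g B = (\<Inter>e\<in>B. \<Inter>\<phi>\<in>line_phases g e.
          (\<lambda>p. line_current (fst p) e \<phi>) -` cball 0 \<bar>current_cap g e\<bar>)"
    by (auto simp: cap_part_def within_caps_iff)
  also have "convex \<dots>"
    by (intro convex_INT convex_linear_vimage linear_line_current convex_cball)
  finally show ?thesis .
qed

lemma continuous_line_current:
  "continuous_on S (\<lambda>p :: 'n :: finite currents \<times> 'n dg_powers. line_current (fst p) e \<phi>)"
  by (rule linear_continuous_on) (rule linear_conv_bounded_linear[THEN iffD1, OF linear_line_current])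

lemma closed_cap_part: "closed (cap_part g B)"
proof -
  have "cap_part g B = (\<Inter>e\<in>B. \<Inter>\<phi>\<in>line_phases g e.
          {p. cmod (line_current (fst p) e \<phi>) \<le> \<bar>current_cap g e\<bar>})"
    by (auto simp: cap_part_def within_caps_iff)
  also have "closed \<dots>"
    by (intro closed_INT ballI closed_Collect_le continuous_intros continuous_line_current)
  finally show ?thesis .
qed

lemma interior_cap_part:
  fixes p :: "'n :: finite currents \<times> 'n dg_powers"
  assumes "strictly_within_caps g B (fst p)"
  shows "p \<in> interior (cap_part g B)"
proof (rule interiorI)
  let ?U = "\<Inter>e\<in>B. \<Inter>\<phi>\<in>line_phases g e. 
      {p :: 'n currents \<times> 'n dg_powers. cmod (line_current (fst p) e \<phi>) < \<bar>current_cap g e\<bar>}"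
  show "open ?U"
    by (intro open_INT ballI open_Collect_less continuous_intros continuous_line_current) auto
  show "p \<in> ?U"
    using assms by (simp add: strictly_within_caps_iff)
  show "?U \<subseteq> cap_part g B"
    by (fastforce simp: cap_part_def within_caps_iff)
qed

lemma polyhedron_affine_part: "polyhedron (affine_part g V B)"
proof -
  have A: "linear (\<lambda>p. A_map g n \<phi> (fst (restr g V B p)))" for n \<phi>
    using linear_compose[OF linear_compose[OF linear_restr linear_fst] linear_A_map] by (simp add: o_def)
  have s: "linear (\<lambda>p. snd (restr g V B p) $ n $ \<phi> $ i)" for n \<phi> i
    by (rule linearI) (simp_all add: linear_add[OF linear_restr] linear_scale[OF linear_restr])
  have le: "polyhedron {p. v \<bullet> A_map g n \<phi> (fst (restr g V B p)) \<le> snd (restr g V B p) $ n $ \<phi> $ i + c}"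
    for v n \<phi> i c
  proof -
    have "linear (\<lambda>p. v \<bullet> A_map g n \<phi> (fst (restr g V B p)) - snd (restr g V B p) $ n $ \<phi> $ i)"
      using A s by (intro linear_compose_sub) (auto simp: linear_iff inner_add_right)
    then show ?thesis
      using polyhedron_linear_le[of _ c] by (force simp: diff_le_eq add.commute)
  qed
  have box: "polyhedron {p. a \<le> snd (restr g V B p) $ n $ \<phi> \<and> snd (restr g V B p) $ n $ \<phi> \<le> b}" for a b n \<phi>
  proof -
    have "polyhedron {p. - (snd (restr g V B p) $ n $ \<phi> $ i) \<le> - (a $ i)}" for i
      using s by (intro polyhedron_linear_le linear_compose_neg)
    then show ?thesis
      unfolding less_eq_vec_def using s
      by (intro polyhedron_Collect_conj polyhedron_Collect_all) (auto intro: polyhedron_linear_le)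
  qed
  have zero: "polyhedron {p. A_map g n \<phi> (fst (restr g V B p)) = 0}" for n \<phi>
  proof -
    have "linear (\<lambda>p. A_map g n \<phi> (fst (restr g V B p)) $ i)" for i
      using A by (auto simp: linear_iff)
    then have "polyhedron {p. A_map g n \<phi> (fst (restr g V B p)) $ i \<le> 0}"
      "polyhedron {p. - (A_map g n \<phi> (fst (restr g V B p)) $ i) \<le> 0}" for i
      by (rule polyhedron_linear_le, intro polyhedron_linear_le linear_compose_neg)
    then have "polyhedron {p. A_map g n \<phi> (fst (restr g V B p)) $ i = 0}" for i
      unfolding order_eq_iff[of _ "0 :: real"] by (intro polyhedron_Collect_conj) auto
    then show ?thesis
      unfolding vec_eq_iff by (intro polyhedron_Collect_all) auto
  qed
  show ?thesis
    unfolding affine_part_def dg_boxes_def node_balances_def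
    by (intro polyhedron_Collect_conj polyhedron_Collect_ball polyhedron_Collect_all polyhedron_Collect_imp
          le box zero finite)
qed

lemma bounded_nested_components:
  fixes S :: "(real ^ 'k :: finite ^ 'm :: finite) set"
  assumes "\<And>v i j. v \<in> S \<Longrightarrow> \<bar>v $ i $ j\<bar> \<le> c i j"
  shows "bounded S"
proof (rule boundedI)
  fix v
  assume v: "v \<in> S"
  have "norm v \<le> (\<Sum>i\<in>UNIV. norm (v $ i))"
    unfolding norm_vec_def by (rule L2_set_le_sum) auto
  also have "\<dots> \<le> (\<Sum>i\<in>UNIV. \<Sum>j\<in>UNIV. c i j)"
    by (intro sum_mono order_trans[OF norm_le_l1_cart] assms v)
  finally show "norm v \<le> (\<Sum>i\<in>UNIV. \<Sum>j\<in>UNIV. c i j)" .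
qed

lemma bounded_doubly_nested_components:
  fixes S :: "(real ^ 'p :: finite ^ 'k :: finite ^ 'm :: finite) set"
  assumes "\<And>v i j q. v \<in> S \<Longrightarrow> \<bar>v $ i $ j $ q\<bar> \<le> c i"
  shows "bounded S"
proof (rule boundedI)
  fix v
  assume v: "v \<in> S"
  have "norm v \<le> (\<Sum>i\<in>UNIV. norm (v $ i))"
    unfolding norm_vec_def by (rule L2_set_le_sum) auto
  also have "\<dots> \<le> (\<Sum>i\<in>UNIV. \<Sum>j\<in>(UNIV :: 'k set). \<Sum>q\<in>(UNIV :: 'p set). c i)"
  proof (rule sum_mono)
    fix i
    have "norm (v $ i) \<le> (\<Sum>j\<in>UNIV. norm (v $ i $ j))"
      unfolding norm_vec_def[of "v $ i"] by (rule L2_set_le_sum) auto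
    also have "\<dots> \<le> (\<Sum>j\<in>(UNIV :: 'k set). \<Sum>q\<in>(UNIV :: 'p set). c i)"
      by (intro sum_mono order_trans[OF norm_le_l1_cart] assms v)
    finally show "norm (v $ i) \<le> \<dots>" .
  qed
  finally show "norm v \<le> (\<Sum>i\<in>UNIV. \<Sum>j\<in>(UNIV :: 'k set). \<Sum>q\<in>(UNIV :: 'p set). c i)" .
qed

lemma compact_feasible_on: "compact (feasible_on g V B)"
proof -
  have "closed {p. restr g V B p = p}"
    using linear_restr[of g V B]
    by (intro closed_Collect_eq continuous_on_id) (simp add: linear_continuous_on linear_conv_bounded_linear)
  moreover have "feasible_on g V B = {p. restr g V B p = p} \<inter> (cap_part g B \<inter> affine_part g V B)"
    using feasible_on_iff by blast
  ultimately have "closed (feasible_on g V B)"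
    by (simp add: closed_Int closed_cap_part polyhedron_imp_closed polyhedron_affine_part)
  moreover have "bounded (feasible_on g V B)"
  proof -
    have "bounded (fst ` feasible_on g V B)"
    proof (rule bounded_nested_components)
      fix \<xi> e and q :: "2 \<times> phase"
      assume "\<xi> \<in> fst ` feasible_on g V B"
      then have \<xi>: "\<xi> \<in> current_space g B" "within_caps g B \<xi>"
        by (auto simp: feasible_on_def)
      obtain r \<phi> where q: "q = (r, \<phi>)"
        by (cases q)
      show "\<bar>\<xi> $ e $ q\<bar> \<le> \<bar>current_cap g e\<bar>"
      proof (cases "e \<in> B \<and> \<phi> \<in> line_phases g e")
        case True
        have "r = 1 \<or> r = 2"
          using exhaust_2 by blast
        then have "\<bar>\<xi> $ e $ q\<bar> \<le> cmod (line_current \<xi> e \<phi>)"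
          using abs_Re_le_cmod[of "line_current \<xi> e \<phi>"] abs_Im_le_cmod[of "line_current \<xi> e \<phi>"]
          by (auto simp: q line_current_def)
        with True \<xi>(2) show ?thesis
          by (force simp: within_caps_iff)
      qed (use \<xi>(1) in \<open>cases e, auto simp: current_space_def q\<close>)
    qed
    moreover have "bounded (snd ` feasible_on g V B)"
    proof (rule bounded_doubly_nested_components)
      fix \<sigma> n \<phi> i
      assume "\<sigma> \<in> snd ` feasible_on g V B"
      then have \<sigma>: "\<sigma> \<in> dg_space g V" "dg_boxes g V \<sigma>"
        by (auto simp: feasible_on_def)
      show "\<bar>\<sigma> $ n $ \<phi> $ i\<bar> \<le> norm (dg_min g n) + norm (dg_max g n)"
      proof (cases "n \<in> V \<and> (\<phi>, n) \<in> dg_units g")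
        case True
        then have "dg_min g n $ i \<le> \<sigma> $ n $ \<phi> $ i" "\<sigma> $ n $ \<phi> $ i \<le> dg_max g n $ i"
          using \<sigma>(2) by (auto simp: dg_boxes_def less_eq_vec_def)
        then show ?thesis
          using component_le_norm_cart[of "dg_min g n" i] component_le_norm_cart[of "dg_max g n" i] by linarith
      qed (use \<sigma>(1) in \<open>auto simp: dg_space_def\<close>)
    qed
    ultimately show ?thesis
      by (rule bounded_subset[OF bounded_Times]) (auto simp: image_iff, force+)
  qed
  ultimately show ?thesis
    by (simp add: compact_eq_bounded_closed)
qed

lemma convex_feasible_on: "convex (feasible_on g V B)"
proof -
  have "convex {p. restr g V B p = p}"
    by (auto simp: convex_def linear_add[OF linear_restr] linear_scale[OF linear_restr])
  moreover have "feasible_on g V B = {p. restr g V B p = p} \<inter> (cap_part g B \<inter> affine_part g V B)"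
    using feasible_on_iff by blast
  ultimately show ?thesis
    by (simp add: convex_Int convex_cap_part polyhedron_imp_convex polyhedron_affine_part)
qed

section \<open>Areas and pairs of areas as agents\<close>

lemma tie_commute: "tie g l j = tie g j l"
  by (auto simp: tie_def)

locale grid =
  fixes g :: "('n :: finite) microgrid"
  assumes wf: "well_formed g"
begin

definition areas :: "nat set" where
  "areas = {1..num_areas g}"

lemma finite_areas [simp]: "finite areas"
  by (simp add: areas_def)

lemma neighbors_iff: "j \<in> neighbors g l \<longleftrightarrow> j \<in> areas \<and> j \<noteq> l \<and> tie g l j \<noteq> {}"
  by (simp add: neighbors_def areas_def)

definition area_of :: "'n \<Rightarrow> nat" where
  "area_of n = (THE l. l \<in> areas \<and> n \<in> area g l)"

lemma ex1_area: "\<exists>!l. l \<in> areas \<and> n \<in> area g l"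
proof -
  have "n \<in> (\<Union>l\<in>areas. area g l)"
    using wf by (simp add: well_formed_def areas_def)
  moreover have "disjoint_family_on (area g) areas"
    using wf by (simp add: well_formed_def areas_def)
  ultimately show ?thesis
    by (fastforce simp: disjoint_family_on_def)
qed

lemma area_of_mem: "area_of n \<in> areas" "n \<in> area g (area_of n)"
  using theI'[OF ex1_area[of n]] by (simp_all add: area_of_def)

lemma area_iff: "l \<in> areas \<Longrightarrow> n \<in> area g l \<longleftrightarrow> area_of n = l"
  using ex1_area[of n] area_of_mem[of n] by blast

lemma tie_iff:
  "l \<in> areas \<Longrightarrow> j \<in> areas \<Longrightarrow> (m, n) \<in> tie g l j \<longleftrightarrow>
     (m, n) \<in> lines g \<and> (area_of m = l \<and> area_of n = j \<or> area_of m = j \<and> area_of n = l)"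
  by (auto simp: tie_def area_iff)

lemma neighbors_commute: "l \<in> areas \<Longrightarrow> j \<in> neighbors g l \<Longrightarrow> l \<in> neighbors g j"
  by (auto simp: neighbors_iff tie_commute)

lemma neighbor_in_areas: "j \<in> neighbors g l \<Longrightarrow> j \<in> areas"
  by (simp add: neighbors_iff)

lemma finite_neighbors: "finite (neighbors g l)"
  by (simp add: neighbors_def)

text \<open>
  A line that leaves area \<open>l\<close> makes the area at its other end a neighbor of \<open>l\<close>.
\<close>

lemma area_lines_iff:
  assumes "l \<in> areas"
  shows "(m, n) \<in> area_lines g l \<longleftrightarrow> (m, n) \<in> lines g \<and> (area_of m = l \<or> area_of n = l)"
proof
  assume "(m, n) \<in> area_lines g l"
  then consider "(m, n) \<in> lines g" "m \<in> area g l" "n \<in> area g l"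
    | j where "j \<in> neighbors g l" "(m, n) \<in> tie g l j"
    by (auto simp: area_lines_def)
  then show "(m, n) \<in> lines g \<and> (area_of m = l \<or> area_of n = l)"
    by cases (auto simp: area_iff[OF assms] tie_iff[OF assms neighbor_in_areas])
next
  assume mn: "(m, n) \<in> lines g \<and> (area_of m = l \<or> area_of n = l)"
  show "(m, n) \<in> area_lines g l"
  proof (cases "area_of m = area_of n")
    case True
    then show ?thesis
      using mn by (auto simp: area_lines_def area_iff[OF assms])
  next
    case False
    define j where "j = (if area_of m = l then area_of n else area_of m)"
    have j: "j \<in> areas" "j \<noteq> l"
      using False mn area_of_mem(1) by (auto simp: j_def)
    then have "(m, n) \<in> tie g l j"
      using mn assms by (auto simp: tie_iff j_def)
    moreover from this j have "j \<in> neighbors g l"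
      by (auto simp: neighbors_iff)
    ultimately show ?thesis
      by (auto simp: area_lines_def)
  qed
qed

definition tie_lines :: "('n \<times> 'n) set" where
  "tie_lines = {(m, n). (m, n) \<in> lines g \<and> area_of m \<noteq> area_of n}"

lemma tie_subset: "l \<in> areas \<Longrightarrow> j \<in> neighbors g l \<Longrightarrow> tie g l j \<subseteq> area_lines g l \<inter> tie_lines"
  by (force simp: tie_iff neighbors_iff tie_lines_def area_lines_iff)

lemma area_tie_lines: "l \<in> areas \<Longrightarrow> area_lines g l \<inter> tie_lines = (\<Union>j\<in>neighbors g l. tie g l j)"
proof (intro equalityI subsetI)
  fix e
  assume l: "l \<in> areas" and e: "e \<in> area_lines g l \<inter> tie_lines"
  obtain m n where mn: "e = (m, n)"
    by (cases e)
  then have "\<not> (m \<in> area g l \<and> n \<in> area g l)"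
    using e l by (auto simp: tie_lines_def area_iff)
  then show "e \<in> (\<Union>j\<in>neighbors g l. tie g l j)"
    using e mn by (auto simp: area_lines_def)
qed (use tie_subset in blast)

lemma disjoint_ties: "l \<in> areas \<Longrightarrow> disjoint_family_on (tie g l) (neighbors g l)"
  by (auto simp: disjoint_family_on_def tie_iff neighbors_iff)

lemma on_lines_area_ties:
  "l \<in> areas \<Longrightarrow> on_lines (area_lines g l \<inter> tie_lines) u = (\<Sum>j\<in>neighbors g l. on_lines (tie g l j) u)"
  by (simp add: area_tie_lines on_lines_UNION disjoint_ties finite_neighbors)

definition pairs :: "(nat \<times> nat) set" where
  "pairs = (SIGMA l:areas. {j. j \<in> neighbors g l \<and> j > l})"

text \<open>
  The participants of the iterations: \<open>Inl l\<close> is area \<open>l\<close>, and \<open>Inr (l, j)\<close> with \<open>l < j\<close> keeps the copy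
  of the currents on the lines that join the neighboring areas \<open>l\<close> and \<open>j\<close>.
\<close>

definition agents :: "(nat + nat \<times> nat) set" where
  "agents = areas <+> pairs"

lemma agents_iff [simp]:
  "Inl l \<in> agents \<longleftrightarrow> l \<in> areas"
  "Inr (l, j) \<in> agents \<longleftrightarrow> l \<in> areas \<and> j \<in> neighbors g l \<and> l < j"
  by (auto simp: agents_def pairs_def)

lemma finite_agents: "finite agents"
  by (auto simp: agents_def pairs_def finite_neighbors)

lemma agents_cases:
  assumes "a \<in> agents"
  obtains l where "a = Inl l" "l \<in> areas"
    | l j where "a = Inr (l, j)" "l \<in> areas" "j \<in> areas" "j \<in> neighbors g l" "l < j"
  using assms by (auto simp: agents_def pairs_def dest: neighbor_in_areas)

lemma ball_agents: "(\<forall>a\<in>agents. P a) \<longleftrightarrow> (\<forall>l\<in>areas. P (Inl l)) \<and> (\<forall>(l, j)\<in>pairs. P (Inr (l, j)))"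
  by (auto simp: agents_def)

lemma sum_agents: "(\<Sum>a\<in>agents. h a) = (\<Sum>l\<in>areas. h (Inl l)) + (\<Sum>(l, j)\<in>pairs. h (Inr (l, j)))"
  by (auto simp: agents_def pairs_def finite_neighbors sum.Plus intro!: sum.cong)

lemma sum_pairs: "(\<Sum>(l, j)\<in>pairs. h l j) = (\<Sum>l\<in>areas. \<Sum>j | j \<in> neighbors g l \<and> j > l. h l j)"
  by (simp add: pairs_def sum.Sigma finite_neighbors)

lemma sum_neighbors_eq_sum_pairs:
  "(\<Sum>l\<in>areas. \<Sum>j\<in>neighbors g l. h l j) = (\<Sum>(l, j)\<in>pairs. h l j + h j l)"
proof -
  let ?S = "SIGMA l:areas. neighbors g l"
  have "pairs \<subseteq> ?S"
    by (auto simp: pairs_def)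
  have swap: "?S - pairs = prod.swap ` pairs"
  proof (intro equalityI subsetI)
    fix q
    assume "q \<in> ?S - pairs"
    then show "q \<in> prod.swap ` pairs"
      by (cases q) (force simp: pairs_def neighbors_iff tie_commute image_iff)
  qed (auto simp: pairs_def neighbors_iff tie_commute)
  have "(\<Sum>l\<in>areas. \<Sum>j\<in>neighbors g l. h l j) = (\<Sum>(l, j)\<in>?S. h l j)"
    by (simp add: sum.Sigma finite_neighbors)
  also have "\<dots> = (\<Sum>(l, j)\<in>?S - pairs. h l j) + (\<Sum>(l, j)\<in>pairs. h l j)"
    using \<open>pairs \<subseteq> ?S\<close> by (intro sum.subset_diff) (auto simp: finite_neighbors)
  also have "(\<Sum>(l, j)\<in>?S - pairs. h l j) = (\<Sum>(l, j)\<in>pairs. h j l)"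
    unfolding swap by (subst sum.reindex) (auto simp: case_prod_beta)
  finally show ?thesis
    by (simp add: sum.distrib case_prod_beta add.commute)
qed

text \<open>
  The copy for a pair of areas owns no nodes. Thus \<open>feasible_on\<close>, applied to the nodes and lines of an
  agent, yields the feasible set of an area in the first case, and just the caps on the currents in the second.
\<close>

fun agent_nodes :: "nat + nat \<times> nat \<Rightarrow> 'n set" where
  "agent_nodes (Inl l) = area g l"
| "agent_nodes (Inr (l, j)) = {}"

fun agent_lines :: "nat + nat \<times> nat \<Rightarrow> ('n \<times> 'n) set" where
  "agent_lines (Inl l) = area_lines g l"
| "agent_lines (Inr (l, j)) = tie g l j"

fun agent_cost :: "nat + nat \<times> nat \<Rightarrow> 'n currents \<times> 'n dg_powers \<Rightarrow> real" where
  "agent_cost (Inl l) p = area_cost g l p + (\<Sum>e\<in>area_switched g l. area_weight g l * norm (fst p $ e))"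
| "agent_cost (Inr (l, j)) p = tie_cost g (tie g l j) (fst p) + tie_weight g (tie g l j) * norm (fst p)"

definition agent_set :: "nat + nat \<times> nat \<Rightarrow> ('n currents \<times> 'n dg_powers) set" where
  "agent_set a = feasible_on g (agent_nodes a) (agent_lines a)"

definition part :: "nat + nat \<times> nat \<Rightarrow> 'n currents \<times> 'n dg_powers \<Rightarrow> 'n currents \<times> 'n dg_powers" where
  "part a = restr g (agent_nodes a) (agent_lines a)"

definition on_ties :: "nat + nat \<times> nat \<Rightarrow> 'n currents \<Rightarrow> 'n currents" where
  "on_ties a = on_lines (agent_lines a \<inter> tie_lines)"

lemma linear_part: "linear (part a)"
  by (simp add: part_def linear_restr)

lemma part_id: "p \<in> agent_set a \<Longrightarrow> part a p = p"
  by (simp add: agent_set_def part_def feasible_on_iff)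

lemma part_mem_iff: "part a p \<in> agent_set a \<longleftrightarrow> p \<in> cap_part g (agent_lines a) \<inter> affine_part g (agent_nodes a) (agent_lines a)"
  by (simp add: agent_set_def part_def restr_feasible_iff)

lemma agent_lines_subset: "a \<in> agents \<Longrightarrow> agent_lines a \<subseteq> lines g"
  by (erule agents_cases) (auto simp: area_lines_def tie_def)

lemma part_on_lines:
  assumes "fst p \<in> current_space g (lines g)" "snd p \<in> dg_space g UNIV" "a \<in> agents"
  shows "part a p = (on_lines (agent_lines a) (fst p), on_nodes (agent_nodes a) (snd p))"
  unfolding part_def using assms agent_lines_subset by (intro restr_on_lines) auto

lemma mr3_objective_eq:
  assumes "fst p \<in> current_space g (lines g)" "snd p \<in> dg_space g UNIV"
  shows "mr3_objective g p = (\<Sum>a\<in>agents. agent_cost a (part a p))"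
proof -
  have sw: "area_switched g l \<subseteq> area_lines g l" if "l \<in> areas" for l
    using wf by (auto simp: area_switched_def area_lines_def well_formed_def)
  have "(\<Sum>a\<in>agents. agent_cost a (part a p)) =
    (\<Sum>a\<in>agents. agent_cost a (on_lines (agent_lines a) (fst p), on_nodes (agent_nodes a) (snd p)))"
    using assms by (simp add: part_on_lines)
  also have "\<dots> = mr3_objective g p"
    unfolding sum_agents agent_cost.simps agent_lines.simps agent_nodes.simps sum_pairs mr3_objective_def case_prod_beta fst_conv
      areas_def[symmetric]
    using sw by (intro arg_cong2[where f = plus] sum.cong refl) auto
  finally show ?thesis
    by simp
qed

text \<open>
  The constraints can be distributed over the agents, because the balance at a node involves only the
  lines that start or end there, and all of these belong to the area of the node.
\<close>

lemma feasible_parts: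
  "p \<in> cap_part g (lines g) \<inter> affine_part g UNIV (lines g) \<longleftrightarrow> (\<forall>a\<in>agents. part a p \<in> agent_set a)"
proof -
  have cap: "p \<in> cap_part g (lines g) \<longleftrightarrow> (\<forall>a\<in>agents. p \<in> cap_part g (agent_lines a))"
  proof -
    have "(m, n) \<in> area_lines g (area_of m)" if "(m, n) \<in> lines g" for m n
      using that area_of_mem by (simp add: area_lines_iff)
    then have "(\<Union>a\<in>agents. agent_lines a) = lines g"
      using agent_lines_subset area_of_mem(1) by (force simp: agents_def)
    then show ?thesis
      unfolding cap_part_def within_caps_def mem_Collect_eq by blast
  qed
  have local: "A_map g n \<phi> (fst (restr g (area g l) (area_lines g l) p)) = A_map g n \<phi> (fst (restr g UNIV (lines g) p))"
    if "l \<in> areas" "n \<in> area g l" for l n \<phi>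
    by (rule A_map_cong) (use that in \<open>auto simp: restr_def area_lines_iff area_iff vec_eq_iff\<close>)
  have dg: "snd (restr g (area g l) B p) $ n = snd (restr g UNIV (lines g) p) $ n" if "n \<in> area g l" for l n B
    using that by (simp add: restr_def)
  define r where "r = restr g UNIV (lines g) p"
  define Q where "Q n \<longleftrightarrow> dg_boxes g {n} (snd r) \<and> node_balances g {n} (fst r) (snd r)" for n
  have "p \<in> affine_part g UNIV (lines g) \<longleftrightarrow> (\<forall>n. Q n)"
    by (auto simp: affine_part_def dg_boxes_def node_balances_def Q_def r_def)
  also have "\<dots> \<longleftrightarrow> (\<forall>l\<in>areas. \<forall>n\<in>area g l. Q n)"
    using area_of_mem by blast
  also have "\<dots> \<longleftrightarrow> (\<forall>l\<in>areas. p \<in> affine_part g (area g l) (area_lines g l))"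
  proof (rule ball_cong[OF refl])
    fix l
    assume l: "l \<in> areas"
    show "(\<forall>n\<in>area g l. Q n) \<longleftrightarrow> p \<in> affine_part g (area g l) (area_lines g l)"
      unfolding affine_part_def dg_boxes_def node_balances_def Q_def r_def mem_Collect_eq ball_conj_distrib
      by (simp add: local[OF l] dg)
  qed
  also have "\<dots> \<longleftrightarrow> (\<forall>a\<in>agents. p \<in> affine_part g (agent_nodes a) (agent_lines a))"
    by (simp add: ball_agents) (simp add: affine_part_def dg_boxes_def node_balances_def)
  finally show ?thesis
    using cap by (auto simp: part_mem_iff)
qed

lemma mr3_feasible_iff:
  "p \<in> mr3_feasible g \<longleftrightarrow> fst p \<in> current_space g (lines g) \<and> snd p \<in> dg_space g UNIV \<and> (\<forall>a\<in>agents. part a p \<in> agent_set a)"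
  unfolding feasible_parts[symmetric] mr3_feasible_def feasible_on_iff restr_eq_iff by blast

lemma part_restr: "a \<in> agents \<Longrightarrow> part a (restr g UNIV (lines g) p) = part a p"
  using agent_lines_subset[of a] by (simp add: part_def restr_restr Int_absorb2)

text \<open>
  The line \<open>(m, n)\<close> takes its current from the area of \<open>m\<close>. For a line between two areas the choice is
  immaterial, as all agents that know the line agree on its current.
\<close>

lemma consensus_glue:
  assumes u: "\<And>a. a \<in> agents \<Longrightarrow> u a \<in> agent_set a"
    and w: "\<And>a. a \<in> agents \<Longrightarrow> on_ties a (fst (u a)) = on_ties a w"
  obtains p where "p \<in> mr3_feasible g" "\<And>a. a \<in> agents \<Longrightarrow> part a p = u a"
proof -
  define p where "p = ((\<chi> e. if e \<in> lines g then fst (u (Inl (area_of (fst e)))) $ e else 0),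
    (\<chi> n. snd (u (Inl (area_of n))) $ n))"
  have space: "fst (u a) \<in> current_space g (agent_lines a)" "snd (u a) \<in> dg_space g (agent_nodes a)" if "a \<in> agents" for a
    using u[OF that] by (auto simp: agent_set_def feasible_on_def)
  have area_agent: "Inl (area_of n) \<in> agents" for n
    by (simp add: area_of_mem)
  have p_space: "fst p \<in> current_space g (lines g)" "snd p \<in> dg_space g UNIV"
    using space[OF area_agent] by (fastforce simp: p_def current_space_def dg_space_def)+
  have "part a p = u a" if a: "a \<in> agents" for a
  proof -
    have tied: "fst (u a) $ e = w $ e" if "e \<in> agent_lines a" "e \<in> tie_lines" "a \<in> agents" for a e
      using arg_cong[OF w[OF that(3)], of "\<lambda>v. v $ e"] that by (simp add: on_ties_def)
    have "fst (u a) $ e = (if e \<in> agent_lines a then fst p $ e else 0)" for e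
    proof (cases "e \<in> agent_lines a")
      case True
      obtain m n where e: "e = (m, n)"
        by (cases e)
      have ln: "e \<in> lines g"
        using True agent_lines_subset[OF a] by blast
      have "fst (u a) $ e = fst (u (Inl (area_of m))) $ e"
      proof (cases "e \<in> tie_lines")
        case tl: True
        have "e \<in> agent_lines (Inl (area_of m))"
          using ln area_of_mem(1) by (simp add: e area_lines_iff)
        then show ?thesis
          using tied[OF True tl a] tied[OF _ tl area_agent[of m]] by simp
      next
        case False
        then have "area_of m = area_of n"
          using ln by (simp add: e tie_lines_def)
        then have "a = Inl (area_of m)"
          using True a by (elim agents_cases) (auto simp: e area_lines_iff tie_iff)
        then show ?thesis
          by simp
      qed
      then show ?thesis
        using True ln by (simp add: p_def e)
    next
      case False
      then show ?thesis
        using space(1)[OF a] by (cases e) (auto simp: current_space_def vec_eq_iff)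
    qed
    moreover have "snd (u a) $ n = (if n \<in> agent_nodes a then snd p $ n else 0)" for n
    proof (cases "n \<in> agent_nodes a")
      case True
      then have "a = Inl (area_of n)"
        using a by (elim agents_cases) (auto simp: area_iff)
      then show ?thesis
        using True by (simp add: p_def)
    next
      case False
      then show ?thesis
        using space(2)[OF a] by (auto simp: dg_space_def vec_eq_iff)
    qed
    ultimately have "fst (u a) = on_lines (agent_lines a) (fst p)" "snd (u a) = on_nodes (agent_nodes a) (snd p)"
      by (intro vec_eq_iff[THEN iffD2] allI; simp)+
    then show ?thesis
      by (simp add: part_on_lines[OF p_space a] prod_eq_iff)
  qed
  moreover from this have "p \<in> mr3_feasible g"
    using p_space u by (simp add: mr3_feasible_iff)
  ultimately show thesis
    using that by blast
qed

section \<open>Existence of multipliers\<close>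

lemma convex_agent_cost:
  assumes "convex_costs g" "a \<in> agents"
  shows "convex_on UNIV (\<lambda>p. agent_cost a (part a p))"
  using assms(2)
proof (cases rule: agents_cases)
  case (1 l)
  have cost: "convex_on (current_space g (area_lines g l) \<times> dg_space g (area g l)) (area_cost g l)"
    and weight: "0 < area_weight g l"
    using assms(1) 1(2) unfolding convex_costs_def areas_def[symmetric] by blast+
  have "convex_on UNIV (\<lambda>p. area_cost g l (part a p))"
    using restr_in_space[of g "area g l" "area_lines g l"]
    by (intro convex_on_compose_linear[OF cost linear_part]) (simp add: mem_Times_iff part_def 1)
  moreover have "linear (\<lambda>p. fst (part a p) $ e)" for e
    by (rule linearI) (simp_all add: linear_add[OF linear_part] linear_scale[OF linear_part])
  then have "convex_on UNIV (\<lambda>p. norm (fst (part a p) $ e))" for e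
    by (intro convex_on_compose_linear[OF convex_on_norm_UNIV]) auto
  ultimately show ?thesis
    using weight unfolding 1(1) agent_cost.simps
    by (intro convex_on_add convex_on_finite_sum convex_on_cmul) (auto simp: area_switched_def)
next
  case (2 l j)
  have cost: "convex_on (current_space g (tie g l j)) (tie_cost g (tie g l j))"
    and weight: "0 < tie_weight g (tie g l j)"
    using assms(1) 2 unfolding convex_costs_def areas_def[symmetric] by blast+
  have lin: "linear (\<lambda>p. fst (part a p))"
    by (rule linearI) (simp_all add: linear_add[OF linear_part] linear_scale[OF linear_part])
  have "convex_on UNIV (\<lambda>p. tie_cost g (tie g l j) (fst (part a p)))"
    using restr_in_space(1)[of g "{}" "tie g l j"]
    by (intro convex_on_compose_linear[OF cost lin]) (simp add: part_def 2)
  moreover have "convex_on UNIV (\<lambda>p. norm (fst (part a p)))"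
    by (intro convex_on_compose_linear[OF convex_on_norm_UNIV lin]) auto
  ultimately show ?thesis
    using weight unfolding 2(1) agent_cost.simps by (intro convex_on_add convex_on_cmul) auto
qed

lemma shared_line_is_tie:
  assumes "a \<in> agents" "b \<in> agents" "a \<noteq> b" "e \<in> agent_lines a" "e \<in> agent_lines b"
  shows "e \<in> tie_lines"
proof -
  obtain m n where e: "e = (m, n)"
    by (cases e)
  show ?thesis
    using assms by (elim agents_cases) (auto simp: e area_lines_iff tie_lines_def tie_iff)
qed

lemma agent_nodes_disjoint:
  "a \<in> agents \<Longrightarrow> b \<in> agents \<Longrightarrow> a \<noteq> b \<Longrightarrow> n \<in> agent_nodes a \<Longrightarrow> n \<notin> agent_nodes b"
  by (elim agents_cases) (auto simp: area_iff)

text \<open>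
  The sum rule, applied to the costs of the agents as functions of the global variable, gives linear
  forms \<open>v a\<close> with sum zero. Such a form depends only on the part that agent \<open>a\<close> sees. It even
  depends only on the tie line currents: along a variable that no other agent sees the sum equals
  \<open>v a\<close>, which therefore vanishes. So the forms are multipliers for the consensus constraints.
\<close>

lemma exists_multipliers:
  assumes costs: "convex_costs g" and slater: "mr3_slater g" and opt: "mr3_optimal g p"
  shows "\<exists>d. (\<forall>w. (\<Sum>a\<in>agents. d a \<bullet> on_ties a w) = 0) \<and>
    (\<forall>a\<in>agents. \<forall>u\<in>agent_set a.
      agent_cost a (part a p) + d a \<bullet> on_ties a (fst (part a p)) \<le> agent_cost a u + d a \<bullet> on_ties a (fst u))"
proof -
  obtain z where z: "z \<in> mr3_feasible g" "strictly_within_caps g (lines g) (fst z)"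
    using slater by (auto simp: mr3_slater_def)
  have p: "p \<in> mr3_feasible g" and p_le: "\<And>q. q \<in> mr3_feasible g \<Longrightarrow> mr3_objective g p \<le> mr3_objective g q"
    using opt by (auto simp: mr3_optimal_def is_arg_min_def not_less)
  let ?C = "\<lambda>a. cap_part g (agent_lines a)"
  let ?P = "\<lambda>a. affine_part g (agent_nodes a) (agent_lines a)"
  have feas: "q \<in> ?C a \<inter> ?P a" if "q \<in> mr3_feasible g" "a \<in> agents" for q a
    using that part_mem_iff[of a q] by (simp add: mr3_feasible_iff)
  obtain v where v_sum: "(\<Sum>a\<in>agents. v a) = 0"
    and v_min: "\<And>a q. a \<in> agents \<Longrightarrow> q \<in> ?C a \<inter> ?P a \<Longrightarrow>
      agent_cost a (part a p) + v a \<bullet> p \<le> agent_cost a (part a q) + v a \<bullet> q"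
  proof (rule convex_sum_rule[where I = agents and f = "\<lambda>a q. agent_cost a (part a q)" and C = ?C and P = ?P
        and z = z and p = p])
    show "convex_on UNIV (\<lambda>q. agent_cost a (part a q)) \<and> convex (?C a) \<and> z \<in> interior (?C a) \<and> p \<in> ?C a"
      if "a \<in> agents" for a
    proof (intro conjI)
      show "z \<in> interior (?C a)"
        using z(2) agent_lines_subset[OF that]
        by (intro interior_cap_part) (auto simp: strictly_within_caps_def)
    qed (use that costs p feas convex_agent_cost convex_cap_part in auto)
    show "polyhedron (?P a) \<and> z \<in> ?P a \<and> p \<in> ?P a" if "a \<in> agents" for a
      using that z p feas polyhedron_affine_part by auto
    fix q
    assume q: "\<forall>a\<in>agents. q \<in> ?C a \<inter> ?P a"
    define q' where "q' = restr g UNIV (lines g) q"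
    have space: "fst q' \<in> current_space g (lines g)" "snd q' \<in> dg_space g UNIV"
      by (simp_all add: q'_def restr_in_space)
    have part: "part a q' = part a q" if "a \<in> agents" for a
      using that by (simp add: q'_def part_restr)
    have "q' \<in> mr3_feasible g"
      using q space by (simp add: mr3_feasible_iff part part_mem_iff)
    then have "mr3_objective g p \<le> mr3_objective g q'"
      by (rule p_le)
    then show "(\<Sum>a\<in>agents. agent_cost a (part a p)) \<le> (\<Sum>a\<in>agents. agent_cost a (part a q))"
      using p space by (simp add: mr3_objective_eq mr3_feasible_iff part cong: sum.cong)
  qed (rule finite_agents, erule that, blast)
  have v_part: "v a \<bullet> q = v a \<bullet> part a q" if a: "a \<in> agents" for a q
  proof -
    \<comment> \<open>moving along h changes nothing for the agent, in either direction\<close>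
    define h where "h = q - part a q"
    have "part a h = 0"
      by (simp add: h_def linear_diff[OF linear_part]) (simp add: part_def restr_restr)
    then have same: "part a (p + t *\<^sub>R h) = part a p" for t
      by (simp add: linear_add[OF linear_part] linear_scale[OF linear_part])
    have "v a \<bullet> p \<le> v a \<bullet> (p + t *\<^sub>R h)" for t
    proof -
      have "p + t *\<^sub>R h \<in> ?C a \<inter> ?P a"
        using part_mem_iff[of a "p + t *\<^sub>R h"] part_mem_iff[of a p] feas[OF p a] same[of t] by simp
      from v_min[OF a this] show ?thesis
        by (simp add: same)
    qed
    from this[of 1] this[of "- 1"] show ?thesis
      by (simp add: h_def inner_add_right inner_diff_right)
  qed
  have v_unseen: "v a \<bullet> h = 0" if a: "a \<in> agents" and h: "\<And>b. b \<in> agents \<Longrightarrow> b \<noteq> a \<Longrightarrow> part b h = 0" for a h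
  proof -
    have "0 = (\<Sum>b\<in>agents. v b \<bullet> h)"
      using v_sum by (simp flip: inner_sum_left)
    also have "\<dots> = (\<Sum>b\<in>agents. if b = a then v a \<bullet> h else 0)"
    proof (rule sum.cong[OF refl])
      show "v b \<bullet> h = (if b = a then v a \<bullet> h else 0)" if "b \<in> agents" for b
        using v_part[OF that, of h] h[OF that] by (cases "b = a") simp_all
    qed
    also have "\<dots> = v a \<bullet> h"
      using a finite_agents by simp
    finally show ?thesis
      by simp
  qed
  have v_ties: "v a \<bullet> u = fst (v a) \<bullet> on_ties a (fst u)" if a: "a \<in> agents" and u: "u \<in> agent_set a" for a u
  proof -
    \<comment> \<open>h collects the internal lines and the nodes of the agent\<close>
    define h where "h = u - (on_ties a (fst u), 0)"
    have space: "fst u \<in> current_space g (agent_lines a)" "snd u \<in> dg_space g (agent_nodes a)"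
      using u by (auto simp: agent_set_def feasible_on_def)
    have "part b h = 0" if b: "b \<in> agents" "b \<noteq> a" for b
    proof -
      have "fst h $ e = 0" if "e \<in> agent_lines b" for e
      proof (cases "e \<in> agent_lines a")
        case True
        then show ?thesis
          using shared_line_is_tie[OF a b(1) _ True that] b(2) by (simp add: h_def on_ties_def)
      next
        case False
        then have "fst u $ e = 0"
          using space(1) by (cases e) (auto simp: current_space_def vec_eq_iff)
        then show ?thesis
          by (simp add: h_def on_ties_def)
      qed
      moreover have "snd h $ n = 0" if "n \<in> agent_nodes b" for n
        using agent_nodes_disjoint[OF b(1) a b(2) that] space(2) by (auto simp: h_def dg_space_def vec_eq_iff)
      ultimately show ?thesis
        by (auto simp: part_def restr_def vec_eq_iff zero_prod_def)
    qed
    then have "v a \<bullet> h = 0"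
      using v_unseen[OF a] by blast
    then show ?thesis
      by (simp add: h_def inner_diff_right inner_prod_def)
  qed
  show ?thesis
  proof (intro exI[of _ "\<lambda>a. fst (v a)"] conjI allI ballI)
    fix w
    let ?q = "(on_lines tie_lines w, 0)"
    have "fst (v a) \<bullet> on_ties a w = v a \<bullet> ?q" if a: "a \<in> agents" for a
    proof -
      have "part a (on_ties a w, 0) = part a ?q"
        by (auto simp: part_def restr_def on_ties_def vec_eq_iff)
      then show ?thesis
        using v_part[OF a, of "(on_ties a w, 0)"] v_part[OF a, of ?q] by (simp add: inner_prod_def)
    qed
    then have "(\<Sum>a\<in>agents. fst (v a) \<bullet> on_ties a w) = (\<Sum>a\<in>agents. v a) \<bullet> ?q"
      by (simp add: inner_sum_left)
    then show "(\<Sum>a\<in>agents. fst (v a) \<bullet> on_ties a w) = 0"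
      by (simp add: v_sum)
  next
    fix a u
    assume a: "a \<in> agents" and u: "u \<in> agent_set a"
    have "u \<in> ?C a \<inter> ?P a"
      using u by (simp add: agent_set_def feasible_on_iff)
    then have "agent_cost a (part a p) + v a \<bullet> p \<le> agent_cost a (part a u) + v a \<bullet> u"
      by (rule v_min[OF a])
    moreover have "part a p \<in> agent_set a"
      using p a by (simp add: mr3_feasible_iff)
    ultimately show "agent_cost a (part a p) + fst (v a) \<bullet> on_ties a (fst (part a p))
        \<le> agent_cost a u + fst (v a) \<bullet> on_ties a (fst u)"
      using v_part[OF a, of p] part_id[OF u] v_ties[OF a u] v_ties[OF a, of "part a p"] by simp
  qed
qed

end

section \<open>The iterations\<close>

lemma tie_sum_commute: "tie_sum g u c l j = tie_sum g u c j l"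
  by (simp add: tie_sum_def tie_commute[of g j l] add.commute)

lemma norm_diff_square: "(norm (u - w))\<^sup>2 = (norm u)\<^sup>2 - 2 * (u \<bullet> w) + (norm (w :: 'a :: real_inner))\<^sup>2"
  by (simp add: power2_norm_eq_inner inner_diff_left inner_diff_right inner_commute)

locale grid_iteration = grid g for g :: "('n :: finite) microgrid" +
  fixes \<kappa> :: real
    and x :: "nat \<Rightarrow> nat \<Rightarrow> 'n currents"
    and s :: "nat \<Rightarrow> nat \<Rightarrow> 'n dg_powers"
    and chi :: "nat \<Rightarrow> ('n \<times> 'n) set \<Rightarrow> 'n currents"
    and gam :: "nat \<Rightarrow> nat \<Rightarrow> nat \<Rightarrow> 'n currents"
    and mu :: "nat \<Rightarrow> ('n \<times> 'n) set \<Rightarrow> 'n currents"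
  assumes costs: "convex_costs g"
    and kappa: "0 < \<kappa>"
    and initial: "initial_point g (x 0) (s 0) (chi 0)"
    and dual_0: "\<forall>l\<in>{1..num_areas g}. \<forall>j\<in>neighbors g l. gam 0 l j = 0 \<and> mu 0 (tie g l j) = 0"
    and S1a: "\<And>i. S1a_step g \<kappa> x s chi gam i"
    and S1b: "\<And>i. S1b_step g \<kappa> x chi mu i"
    and S2: "\<And>i. S2_step g \<kappa> x chi gam mu i"
begin

definition iterate :: "nat \<Rightarrow> nat + nat \<times> nat \<Rightarrow> 'n currents \<times> 'n dg_powers" where
  "iterate i a = (case a of Inl l \<Rightarrow> (x i l, s i l) | Inr (l, j) \<Rightarrow> (chi i (tie g l j), 0))"

definition multiplier :: "nat \<Rightarrow> nat + nat \<times> nat \<Rightarrow> 'n currents" where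
  "multiplier i a = (case a of Inl l \<Rightarrow> \<Sum>j\<in>neighbors g l. gam i l j | Inr (l, j) \<Rightarrow> - mu i (tie g l j))"

text \<open>
  The consensus variable does not occur in the iterations: it has been eliminated, being the average of
  the three versions of each tie line current.
\<close>

definition consensus :: "nat \<Rightarrow> 'n currents" where
  "consensus i = (\<chi> e. if e \<in> tie_lines
     then (1 / 3) *\<^sub>R tie_sum g (x i) (chi i) (area_of (fst e)) (area_of (snd e)) $ e else 0)"

lemma S1a_minimizer:
  assumes "l \<in> areas"
  shows "(x (Suc i) l, s (Suc i) l) \<in> area_feasible g l"
    and "p \<in> area_feasible g l \<Longrightarrow> S1a_objective g \<kappa> (x i) (chi i) (gam i) l (x (Suc i) l, s (Suc i) l)
           \<le> S1a_objective g \<kappa> (x i) (chi i) (gam i) l p"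
  using S1a[of i] assms unfolding S1a_step_def is_arg_min_def areas_def[symmetric]
  by (cases p, auto simp: not_less)+

lemma S1b_minimizer:
  assumes "l \<in> areas" "j \<in> neighbors g l"
  shows "chi (Suc i) (tie g l j) \<in> current_space g (tie g l j)"
    and "within_caps g (tie g l j) (chi (Suc i) (tie g l j))"
    and "c \<in> current_space g (tie g l j) \<Longrightarrow> within_caps g (tie g l j) c \<Longrightarrow>
           S1b_objective g \<kappa> (x i) (chi i) (mu i) l j (chi (Suc i) (tie g l j))
           \<le> S1b_objective g \<kappa> (x i) (chi i) (mu i) l j c"
  using S1b[of i] assms unfolding S1b_step_def is_arg_min_def areas_def[symmetric] by (auto simp: not_less)

lemma chi_space:
  assumes "l \<in> areas" "j \<in> neighbors g l"
  shows "chi i (tie g l j) \<in> current_space g (tie g l j)"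
proof (cases i)
  case 0
  then show ?thesis
    using initial assms by (simp add: initial_point_def areas_def)
next
  case (Suc i')
  then show ?thesis
    using S1b_minimizer(1)[OF assms] by simp
qed

lemma on_lines_chi:
  "l \<in> areas \<Longrightarrow> j \<in> neighbors g l \<Longrightarrow> on_lines (tie g l j) (chi i (tie g l j)) = chi i (tie g l j)"
  by (rule current_space_on_lines[OF chi_space])

lemma consensus_on_tie:
  assumes l: "l \<in> areas" and j: "j \<in> neighbors g l"
  shows "on_lines (tie g l j) (consensus i) = (1 / 3) *\<^sub>R tie_sum g (x i) (chi i) l j"
proof -
  have "on_lines (tie g l j) (consensus i) $ e = (1 / 3) *\<^sub>R tie_sum g (x i) (chi i) l j $ e" for e
  proof (cases "e \<in> tie g l j")
    case True
    obtain m n where e: "e = (m, n)"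
      by (cases e)
    have "area_of m = l \<and> area_of n = j \<or> area_of m = j \<and> area_of n = l"
      using True tie_iff[OF l neighbor_in_areas[OF j]] by (auto simp: e)
    then show ?thesis
      using True tie_subset[OF l j] tie_sum_commute[of g "x i" "chi i" l j] by (auto simp: consensus_def e)
  next
    case False
    then have "chi i (tie g l j) $ e = 0"
      using on_lines_chi[OF l j, of i] by (metis on_lines_nth)
    with False show ?thesis
      by (simp add: tie_sum_def)
  qed
  then show ?thesis
    by (intro vec_eq_iff[THEN iffD2] allI) simp
qed

text \<open>
  A step of \<open>\<kappa> / 3\<close> along twice one version minus the other two is a step of \<open>\<kappa>\<close> along the deviation
  of that version from the average.
\<close>

lemma gam_step:
  "l \<in> areas \<Longrightarrow> j \<in> neighbors g l \<Longrightarrow> gam (Suc i) l j = gam i l j +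
     \<kappa> *\<^sub>R (on_lines (tie g l j) (x (Suc i) l) - on_lines (tie g l j) (consensus (Suc i)))"
  and mu_step:
  "l \<in> areas \<Longrightarrow> j \<in> neighbors g l \<Longrightarrow> mu (Suc i) (tie g l j) = mu i (tie g l j) -
     \<kappa> *\<^sub>R (chi (Suc i) (tie g l j) - on_lines (tie g l j) (consensus (Suc i)))"
proof -
  assume l: "l \<in> areas" and j: "j \<in> neighbors g l"
  have third: "(\<kappa> / 3) *\<^sub>R v = \<kappa> *\<^sub>R ((1 / 3) *\<^sub>R v)" for v :: "'n currents"
    by simp
  have *: "gam (Suc i) l j = gam i l j + (\<kappa> / 3) *\<^sub>R
          (2 *\<^sub>R on_lines (tie g l j) (x (Suc i) l) - on_lines (tie g l j) (x (Suc i) j)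
             - chi (Suc i) (tie g l j))"
    "mu (Suc i) (tie g l j) = mu i (tie g l j) + (\<kappa> / 3) *\<^sub>R
          (on_lines (tie g l j) (x (Suc i) l) + on_lines (tie g l j) (x (Suc i) j)
             - 2 *\<^sub>R chi (Suc i) (tie g l j))"
    using S2[of i] l j by (auto simp: S2_step_def areas_def)
  have avg: "(1 / 3) *\<^sub>R (2 *\<^sub>R p - q - c) = p - (1 / 3) *\<^sub>R (p + q + c)"
    "(1 / 3) *\<^sub>R (p + q - 2 *\<^sub>R c) = - (c - (1 / 3) *\<^sub>R (p + q + c))" for p q c :: "'n currents"
    by (auto simp: vec_eq_iff field_simps)
  show "gam (Suc i) l j = gam i l j +
     \<kappa> *\<^sub>R (on_lines (tie g l j) (x (Suc i) l) - on_lines (tie g l j) (consensus (Suc i)))"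
    unfolding * consensus_on_tie[OF l j] tie_sum_def third avg ..
  show "mu (Suc i) (tie g l j) = mu i (tie g l j) -
     \<kappa> *\<^sub>R (chi (Suc i) (tie g l j) - on_lines (tie g l j) (consensus (Suc i)))"
    unfolding * consensus_on_tie[OF l j] tie_sum_def third avg scaleR_minus_right
    by (rule diff_conv_add_uminus[symmetric])
qed

lemma on_lines_gam:
  assumes "l \<in> areas" "j \<in> neighbors g l"
  shows "on_lines (tie g l j) (gam i l j) = gam i l j"
proof (induction i)
  case 0
  then show ?case
    using dual_0 assms by (simp add: areas_def linear_0[OF linear_on_lines])
next
  case (Suc i)
  then show ?case
    by (simp add: gam_step[OF assms] linear_add[OF linear_on_lines] linear_diff[OF linear_on_lines]
        linear_scale[OF linear_on_lines])
qed

text \<open>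
  The deviations from an average add up to zero, so the initial balance of the multipliers persists. The
  sign of \<open>mu\<close> is opposite to that of a multiplier of the copy.
\<close>

lemma dual_balance:
  assumes l: "l \<in> areas" and j: "j \<in> neighbors g l"
  shows "gam i l j + gam i j l = mu i (tie g l j)"
proof (induction i)
  case 0
  have "gam 0 l j = 0" "mu 0 (tie g l j) = 0" "gam 0 j l = 0"
    using dual_0 l j neighbors_commute[OF l j] neighbor_in_areas[OF j] by (auto simp: areas_def)
  then show ?case
    by simp
next
  case (Suc i)
  have zero: "(p - (1 / 3) *\<^sub>R (p + q + c)) + (q - (1 / 3) *\<^sub>R (p + q + c)) = - (c - (1 / 3) *\<^sub>R (p + q + c))"
    for p q c :: "'n currents"
    by (auto simp: vec_eq_iff field_simps)
  let ?T = "on_lines (tie g l j)" and ?z = "on_lines (tie g l j) (consensus (Suc i))"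
  have "(?T (x (Suc i) l) - ?z) + (?T (x (Suc i) j) - ?z) = - (chi (Suc i) (tie g l j) - ?z)"
    unfolding consensus_on_tie[OF l j] tie_sum_def by (rule zero)
  then have step: "\<kappa> *\<^sub>R (?T (x (Suc i) l) - ?z) + \<kappa> *\<^sub>R (?T (x (Suc i) j) - ?z)
      = - (\<kappa> *\<^sub>R (chi (Suc i) (tie g l j) - ?z))"
    by (metis scaleR_right_distrib scaleR_minus_right)
  have "gam (Suc i) l j + gam (Suc i) j l = (gam i l j + gam i j l)
      + (\<kappa> *\<^sub>R (?T (x (Suc i) l) - ?z) + \<kappa> *\<^sub>R (?T (x (Suc i) j) - ?z))"
    unfolding gam_step[OF l j] gam_step[OF neighbor_in_areas[OF j] neighbors_commute[OF l j]]
      tie_commute[of g j l] by (simp only: add.assoc add.left_commute)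
  also have "\<dots> = mu (Suc i) (tie g l j)"
    unfolding Suc.IH step mu_step[OF l j] by simp
  finally show ?case .
qed

lemma on_ties_Inl: "l \<in> areas \<Longrightarrow> on_ties (Inl l) w = (\<Sum>j\<in>neighbors g l. on_lines (tie g l j) w)"
  by (simp add: on_ties_def on_lines_area_ties)

lemma on_ties_Inr: "l \<in> areas \<Longrightarrow> j \<in> neighbors g l \<Longrightarrow> on_ties (Inr (l, j)) w = on_lines (tie g l j) w"
  using tie_subset by (simp add: on_ties_def Int_absorb2)

lemma gam_inner:
  assumes l: "l \<in> areas" and j: "j \<in> neighbors g l"
  shows "gam i l j \<bullet> on_ties (Inl l) w = gam i l j \<bullet> on_lines (tie g l j) w"
proof -
  have "gam i l j \<bullet> on_ties (Inl l) w = gam i l j \<bullet> on_lines (tie g l j) (on_ties (Inl l) w)"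
    using on_lines_gam[OF l j, of i] by (metis inner_on_lines_commute)
  also have "on_lines (tie g l j) (on_ties (Inl l) w) = on_lines (tie g l j) w"
    using tie_subset[OF l j] by (simp add: on_ties_def Int_absorb2)
  finally show ?thesis .
qed

lemma multiplier_Inl_inner:
  "l \<in> areas \<Longrightarrow> multiplier i (Inl l) \<bullet> on_ties (Inl l) w = (\<Sum>j\<in>neighbors g l. gam i l j \<bullet> on_lines (tie g l j) w)"
  by (simp add: multiplier_def inner_sum_left gam_inner)

lemma multiplier_Inr: "multiplier i (Inr (l, j)) = - mu i (tie g l j)"
  by (simp add: multiplier_def)

lemma multiplier_orthogonal: "(\<Sum>a\<in>agents. multiplier i a \<bullet> on_ties a w) = 0"
proof -
  have "(\<Sum>a\<in>agents. multiplier i a \<bullet> on_ties a w)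
      = (\<Sum>l\<in>areas. \<Sum>j\<in>neighbors g l. gam i l j \<bullet> on_lines (tie g l j) w)
        + (\<Sum>(l, j)\<in>pairs. - (mu i (tie g l j) \<bullet> on_lines (tie g l j) w))"
    unfolding sum_agents
    by (intro arg_cong2[where f = plus] sum.cong refl)
       (auto simp: multiplier_Inl_inner on_ties_Inr pairs_def multiplier_Inr)
  also have "\<dots> = (\<Sum>(l, j)\<in>pairs. gam i l j \<bullet> on_lines (tie g l j) w + gam i j l \<bullet> on_lines (tie g l j) w
        - mu i (tie g l j) \<bullet> on_lines (tie g l j) w)"
    unfolding sum_neighbors_eq_sum_pairs sum.distrib[symmetric]
    by (intro sum.cong refl) (auto simp: tie_commute)
  also have "\<dots> = 0"
  proof (rule sum.neutral, clarify)
    fix l j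
    assume "(l, j) \<in> pairs"
    then have "gam i l j + gam i j l = mu i (tie g l j)"
      by (auto simp: pairs_def intro: dual_balance)
    then show "gam i l j \<bullet> on_lines (tie g l j) w + gam i j l \<bullet> on_lines (tie g l j) w
        - mu i (tie g l j) \<bullet> on_lines (tie g l j) w = 0"
      by (metis diff_self inner_add_left)
  qed
  finally show ?thesis .
qed

lemma iterate_in:
  assumes "a \<in> agents"
  shows "iterate (Suc i) a \<in> agent_set a"
  using assms
proof (cases rule: agents_cases)
  case (1 l)
  then show ?thesis
    using S1a_minimizer(1)[of l i] by (simp add: iterate_def agent_set_def area_feasible_def)
next
  case (2 l j)
  then show ?thesis
    using S1b_minimizer(1,2)[of l j i]
    by (simp add: iterate_def agent_set_def feasible_on_def dg_space_def dg_boxes_def node_balances_def)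
qed

lemma multiplier_step:
  assumes "a \<in> agents"
  shows "multiplier (Suc i) a = multiplier i a
    + \<kappa> *\<^sub>R (on_ties a (fst (iterate (Suc i) a)) - on_ties a (consensus (Suc i)))"
  using assms
proof (cases rule: agents_cases)
  case (1 l)
  then show ?thesis
    by (simp add: multiplier_def iterate_def on_ties_Inl gam_step sum.distrib scaleR_sum_right
        flip: sum_subtractf)
next
  case (2 l j)
  then show ?thesis
    by (simp add: multiplier_def iterate_def on_ties_Inr on_lines_chi mu_step)
qed

text \<open>
  Expanding the square shows that the augmented Lagrangian of an agent differs from the objective of its
  step by the squared norm of the consensus variable, which is a constant.
\<close>

lemma iterate_minimizes:
  fixes i :: nat
  assumes a: "a \<in> agents" and u: "u \<in> agent_set a"
  defines "\<Phi> \<equiv> \<lambda>v. agent_cost a v + multiplier i a \<bullet> on_ties a (fst v)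
      + \<kappa> / 2 * (norm (on_ties a (fst v) - on_ties a (consensus i)))\<^sup>2"
  shows "\<Phi> (iterate (Suc i) a) \<le> \<Phi> u"
  using a
proof (cases rule: agents_cases)
  case (1 l)
  let ?S = "S1a_objective g \<kappa> (x i) (chi i) (gam i) l"
  let ?t = "\<lambda>j. on_lines (tie g l j)" and ?A = "on_ties (Inl l)"
  have idem: "?A (?A w) = ?A w" for w
    by (simp add: on_ties_def)
  have self: "?A v \<bullet> ?A w = (\<Sum>j\<in>neighbors g l. ?t j v \<bullet> ?t j w)" for v w
  proof -
    have "?A v \<bullet> ?A w = v \<bullet> ?A w"
      using idem by (simp add: on_ties_def inner_on_lines_commute)
    also have "\<dots> = (\<Sum>j\<in>neighbors g l. ?t j v \<bullet> ?t j w)"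
      by (simp add: on_ties_Inl[OF 1(2)] inner_sum_right inner_on_lines_commute)
    finally show ?thesis .
  qed
  have "\<Phi> v = ?S v + \<kappa> / 2 * (norm (?A (consensus i)))\<^sup>2" for v
  proof -
    have "(norm (?A (fst v)))\<^sup>2 = (\<Sum>j\<in>neighbors g l. (norm (?t j (fst v)))\<^sup>2)"
      by (simp add: power2_norm_eq_inner self)
    moreover have "?A (fst v) \<bullet> ?A (consensus i)
        = (\<Sum>j\<in>neighbors g l. (1 / 3) * (?t j (fst v) \<bullet> tie_sum g (x i) (chi i) l j))"
      unfolding self by (intro sum.cong refl) (simp add: consensus_on_tie 1)
    ultimately show ?thesis
      unfolding \<Phi>_def S1a_objective_def case_prod_beta norm_diff_square 1(1) multiplier_Inl_inner[OF 1(2)]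
      by (simp add: sum.distrib sum_subtractf sum_distrib_left algebra_simps)
  qed
  moreover have "?S (iterate (Suc i) a) \<le> ?S u"
    using S1a_minimizer(2)[OF 1(2), of u i] u by (simp add: 1(1) iterate_def agent_set_def area_feasible_def)
  ultimately show ?thesis
    by simp
next
  case (2 l j)
  let ?S = "S1b_objective g \<kappa> (x i) (chi i) (mu i) l j"
  let ?z = "(1 / 3) *\<^sub>R tie_sum g (x i) (chi i) l j"
  have "\<Phi> v = ?S (fst v) + \<kappa> / 2 * (norm ?z)\<^sup>2" if "v \<in> agent_set a" for v
  proof -
    have "on_lines (tie g l j) (fst v) = fst v"
      using that by (intro current_space_on_lines) (auto simp: agent_set_def feasible_on_def 2)
    then show ?thesis
      unfolding \<Phi>_def S1b_objective_def 2(1) on_ties_Inr[OF 2(2,4)] consensus_on_tie[OF 2(2,4)] norm_diff_square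
      by (simp add: multiplier_def inner_add_right algebra_simps inner_commute)
  qed
  moreover have "?S (fst (iterate (Suc i) a)) \<le> ?S (fst u)"
    using S1b_minimizer(3)[OF 2(2,4), of "fst u" i] u
    by (auto simp: 2(1) iterate_def agent_set_def feasible_on_def)
  ultimately show ?thesis
    using iterate_in[OF a] u by simp
qed

lemma bounded_iterate:
  assumes "a \<in> agents"
  shows "bounded (range (\<lambda>i. fst (iterate i a)))"
proof (rule bounded_subset)
  show "bounded (insert (fst (iterate 0 a)) (fst ` agent_set a))"
    unfolding agent_set_def by (simp add: bounded_fst compact_imp_bounded compact_feasible_on)
  show "range (\<lambda>i. fst (iterate i a)) \<subseteq> insert (fst (iterate 0 a)) (fst ` agent_set a)"
  proof clarify
    fix i
    assume "fst (iterate i a) \<notin> fst ` agent_set a"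
    then show "fst (iterate i a) = fst (iterate 0 a)"
      using iterate_in[OF assms] by (cases i) auto
  qed
qed

lemma bounded_consensus: "bounded (range consensus)"
proof -
  have "bounded (\<Union>a\<in>agents. range (\<lambda>i. fst (iterate i a)))"
    by (intro bounded_UN finite_agents ballI bounded_iterate)
  then obtain C where C: "\<And>a i. a \<in> agents \<Longrightarrow> norm (fst (iterate i a)) \<le> C"
    unfolding bounded_iff by blast
  have comp: "norm (fst (iterate i a) $ e) \<le> C" if "a \<in> agents" for a i e
    using C[OF that, of i] Finite_Cartesian_Product.norm_nth_le order_trans by blast
  have "norm (consensus i $ e) \<le> \<bar>C\<bar>" for i e
  proof (cases "e \<in> tie_lines")
    case True
    obtain m n where e: "e = (m, n)"
      by (cases e)
    have bound: "norm (tie_sum g (x i) (chi i) l j $ e) \<le> 3 * C" if lj: "(l, j) \<in> pairs" for l j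
    proof -
      have l: "Inl l \<in> agents" and j: "Inl j \<in> agents" and "Inr (l, j) \<in> agents"
        using lj neighbor_in_areas by (auto simp: pairs_def)
      have x: "norm (on_lines (tie g l j) (x i k) $ e) \<le> C" if "Inl k \<in> agents" for k
        using comp[OF that, of i e] order_trans[OF norm_ge_zero comp[OF that, of i e]]
        by (auto simp: iterate_def)
      have "norm (chi i (tie g l j) $ e) \<le> C"
        using comp[OF \<open>Inr (l, j) \<in> agents\<close>, of i e] by (simp add: iterate_def)
      then show ?thesis
        using x[OF l] x[OF j] unfolding tie_sum_def vector_add_component
        by (intro norm_triangle_le) (auto intro!: order_trans[OF add_mono[OF norm_triangle_ineq order_refl]])
    qed
    have "area_of m \<noteq> area_of n" "(m, n) \<in> lines g"
      using True by (auto simp: tie_lines_def e)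
    then have "(m, n) \<in> tie g (area_of m) (area_of n)"
      using tie_iff[OF area_of_mem(1) area_of_mem(1)] by blast
    then have "area_of m \<in> neighbors g (area_of n)" "area_of n \<in> neighbors g (area_of m)"
      using area_of_mem(1) \<open>area_of m \<noteq> area_of n\<close> by (auto simp: neighbors_iff tie_commute)
    then have "(area_of m, area_of n) \<in> pairs \<or> (area_of n, area_of m) \<in> pairs"
      using \<open>area_of m \<noteq> area_of n\<close> area_of_mem(1) by (auto simp: pairs_def)
    then have "norm (tie_sum g (x i) (chi i) (area_of m) (area_of n) $ e) \<le> 3 * C"
      using bound tie_sum_commute by metis
    then show ?thesis
      using True by (simp add: consensus_def e)
  qed (simp add: consensus_def)
  then have "norm (consensus i) \<le> (\<Sum>e\<in>(UNIV :: ('n \<times> 'n) set). \<bar>C\<bar>)" for i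
    unfolding norm_vec_def[of "consensus i"] by (intro order_trans[OF L2_set_le_sum] sum_mono) auto
  then show ?thesis
    unfolding bounded_iff by blast
qed

lemma agent_cost_part: "p \<in> agent_set a \<Longrightarrow> agent_cost a (part a p) = agent_cost a p"
  by (simp add: part_id)

lemma convex_on_agent_cost:
  assumes "a \<in> agents"
  shows "convex_on (agent_set a) (agent_cost a)"
proof -
  have conv: "convex (agent_set a)"
    by (simp add: agent_set_def convex_feasible_on)
  have "convex_on (agent_set a) (\<lambda>p. agent_cost a (part a p))"
    by (rule convex_on_subset[OF convex_agent_cost[OF costs assms] _ conv]) simp
  then show ?thesis
    using conv unfolding convex_on_def by (simp add: agent_cost_part convexD)
qed

lemma continuous_on_agent_cost:
  assumes "a \<in> agents"
  shows "continuous_on (agent_set a) (agent_cost a)"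
proof -
  have "continuous_on UNIV (\<lambda>p. agent_cost a (part a p))"
    by (rule convex_on_continuous[OF open_UNIV convex_agent_cost[OF costs assms]])
  then have "continuous_on (agent_set a) (\<lambda>p. agent_cost a (part a p))"
    by (rule continuous_on_subset) simp
  then show ?thesis
    by (rule continuous_on_eq) (rule agent_cost_part)
qed

lemma linear_on_ties: "linear (on_ties a)"
  unfolding on_ties_def by (rule linear_on_lines)

lemma linear_on_ties_fst: "linear (\<lambda>p :: 'n currents \<times> 'n dg_powers. on_ties a (fst p))"
  using linear_compose[OF linear_fst linear_on_ties] by (simp add: o_def)

lemma compact_agent_set: "compact (agent_set a)"
  by (simp add: agent_set_def compact_feasible_on)

sublocale consensus_admm agents agent_set agent_cost "\<lambda>a p. on_ties a (fst p)" on_ties \<kappa>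
  iterate consensus multiplier
  by (rule consensus_admm.intro;
      intro finite_agents compact_agent_set convex_on_agent_cost continuous_on_agent_cost linear_on_ties_fst
        linear_on_ties kappa iterate_in iterate_minimizes multiplier_step multiplier_orthogonal bounded_consensus;
      assumption)

lemma iterates_converge:
  assumes slater: "mr3_slater g" and opt: "mr3_optimal g p"
    and unique: "\<And>q. mr3_optimal g q \<Longrightarrow> q = p" and a: "a \<in> agents"
  shows "(\<lambda>i. iterate i a) \<longlonglongrightarrow> part a p" and "convergent (\<lambda>i. multiplier i a)"
proof -
  obtain d where d: "\<forall>w. (\<Sum>a\<in>agents. d a \<bullet> on_ties a w) = 0"
    "\<forall>a\<in>agents. \<forall>u\<in>agent_set a.
      agent_cost a (part a p) + d a \<bullet> on_ties a (fst (part a p)) \<le> agent_cost a u + d a \<bullet> on_ties a (fst u)"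
    using exists_multipliers[OF costs slater opt] by blast
  have p: "p \<in> mr3_feasible g"
    using opt by (simp add: mr3_optimal_def is_arg_min_def)
  have "on_ties a (fst (part a p)) = on_ties a (fst p)" if "a \<in> agents" for a
    using p that by (simp add: part_on_lines mr3_feasible_iff on_ties_def Int_commute Int_left_commute flip: Int_assoc)
  then have sad: "saddle (\<lambda>a. part a p) (fst p) d"
    using d p by (auto simp: saddle_def mr3_feasible_iff)
  have uniq: "\<forall>a\<in>agents. u a = part a p"
    if u: "\<And>a. a \<in> agents \<Longrightarrow> u a \<in> agent_set a \<and> on_ties a (fst (u a)) = on_ties a w"
      and le: "(\<Sum>a\<in>agents. agent_cost a (u a)) \<le> (\<Sum>a\<in>agents. agent_cost a (part a p))" for u w
  proof -
    obtain q where q: "q \<in> mr3_feasible g" "\<And>a. a \<in> agents \<Longrightarrow> part a q = u a"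
      using consensus_glue[of u w] u by blast
    have "mr3_objective g q \<le> mr3_objective g p"
      using le p q by (simp add: mr3_objective_eq mr3_feasible_iff cong: sum.cong)
    then have "mr3_optimal g q"
      using opt q(1) unfolding mr3_optimal_def is_arg_min_def by (meson not_less order_trans)
    then have "q = p"
      by (rule unique)
    with q(2) show ?thesis
      by simp
  qed
  show "(\<lambda>i. iterate i a) \<longlonglongrightarrow> part a p" and "convergent (\<lambda>i. multiplier i a)"
    by (rule convergence[OF sad _ a], fact uniq)+
qed

end

theorem proposition2:
  fixes g :: "('n :: finite) microgrid"
    and \<kappa> :: real
    and x :: "nat \<Rightarrow> nat \<Rightarrow> 'n currents"
    and s :: "nat \<Rightarrow> nat \<Rightarrow> 'n dg_powers"
    and chi :: "nat \<Rightarrow> ('n \<times> 'n) set \<Rightarrow> 'n currents"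
    and gam :: "nat \<Rightarrow> nat \<Rightarrow> nat \<Rightarrow> 'n currents"
    and mu :: "nat \<Rightarrow> ('n \<times> 'n) set \<Rightarrow> 'n currents"
    and xi_opt :: "'n currents"
    and sigma_opt :: "'n dg_powers"
  assumes "well_formed g"
    and "convex_costs g"
    and "mr3_slater g"
    and "mr3_optimal g (xi_opt, sigma_opt)"
    and "\<And>p. mr3_optimal g p \<Longrightarrow> p = (xi_opt, sigma_opt)"
    and "\<kappa> > 0"
    and "initial_point g (x 0) (s 0) (chi 0)"
    and "\<forall>l\<in>{1..num_areas g}. \<forall>j\<in>neighbors g l. gam 0 l j = 0 \<and> mu 0 (tie g l j) = 0"
    and "\<And>i. S1a_step g \<kappa> x s chi gam i"
    and "\<And>i. S1b_step g \<kappa> x chi mu i"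
    and "\<And>i. S2_step g \<kappa> x chi gam mu i"
  shows "\<forall>l\<in>{1..num_areas g}.
           convergent (\<lambda>i. x i l) \<and> convergent (\<lambda>i. s i l) \<and>
           (\<forall>j\<in>neighbors g l.
              convergent (\<lambda>i. chi i (tie g l j)) \<and>
              convergent (\<lambda>i. gam i l j) \<and>
              convergent (\<lambda>i. mu i (tie g l j))) \<and>
           (\<lambda>i. x i l) \<longlonglongrightarrow> on_lines (area_lines g l) xi_opt \<and>
           (\<lambda>i. s i l) \<longlonglongrightarrow> on_nodes (area g l) sigma_opt"
proof -
  interpret grid_iteration g \<kappa> x s chi gam mu
    using assms(1,2,6-11) by unfold_locales
  have primal: "(\<lambda>i. iterate i a) \<longlonglongrightarrow> part a (xi_opt, sigma_opt)"
    and dual: "convergent (\<lambda>i. multiplier i a)" if "a \<in> agents" for a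
    by (rule iterates_converge[OF assms(3,4) _ that], rule assms(5), assumption)+
  have space: "xi_opt \<in> current_space g (lines g)" "sigma_opt \<in> dg_space g UNIV"
    using assms(4) by (auto simp: mr3_optimal_def is_arg_min_def mr3_feasible_iff)
  show ?thesis
    unfolding areas_def[symmetric]
  proof (intro ballI conjI)
    fix l
    assume l: "l \<in> areas"
    then have agent: "Inl l \<in> agents"
      by simp
    have "(\<lambda>i. (x i l, s i l)) \<longlonglongrightarrow> (on_lines (area_lines g l) xi_opt, on_nodes (area g l) sigma_opt)"
      using primal[OF agent] part_on_lines[of "(xi_opt, sigma_opt)", OF _ _ agent] space by (simp add: iterate_def)
    from tendsto_fst[OF this] tendsto_snd[OF this]
    show x_lim: "(\<lambda>i. x i l) \<longlonglongrightarrow> on_lines (area_lines g l) xi_opt"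
      and s_lim: "(\<lambda>i. s i l) \<longlonglongrightarrow> on_nodes (area g l) sigma_opt"
      by simp_all
    show "convergent (\<lambda>i. x i l)"
      using x_lim by (rule convergentI)
    show "convergent (\<lambda>i. s i l)"
      using s_lim by (rule convergentI)
    fix j
    assume j: "j \<in> neighbors g l"
    obtain l' j' where pair: "Inr (l', j') \<in> agents" "tie g l j = tie g l' j'"
    proof (cases "l < j")
      case True
      then show ?thesis
        using that[of l j] l j by simp
    next
      case False
      then have "j < l"
        using j by (auto simp: neighbors_iff)
      then show ?thesis
        using that[of j l] neighbors_commute[OF l j] neighbor_in_areas[OF j]
        by (simp add: tie_commute)
    qed
    show "convergent (\<lambda>i. chi i (tie g l j))"
      using tendsto_fst[OF primal[OF pair(1)]] pair(2) by (auto simp: iterate_def intro: convergentI)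
    show "convergent (\<lambda>i. mu i (tie g l j))"
      using dual[OF pair(1)] pair(2) by (simp add: multiplier_def convergent_minus_iff[symmetric])
    obtain D where "(\<lambda>i. multiplier i (Inl l)) \<longlonglongrightarrow> D"
      using dual[OF agent] by (auto simp: convergent_def)
    then have "(\<lambda>i. on_lines (tie g l j) (multiplier i (Inl l))) \<longlonglongrightarrow> on_lines (tie g l j) D"
      by (rule tendsto_linear[OF linear_on_lines])
    moreover have "on_lines (tie g l j) (multiplier i (Inl l)) = gam i l j" for i
    proof -
      have "on_lines (tie g l j) (gam i l k) = (if k = j then gam i l j else 0)" if k: "k \<in> neighbors g l" for k
      proof (cases "k = j")
        case False
        then have "tie g l j \<inter> tie g l k = {}"
          using disjoint_ties[OF l] j k by (auto simp: disjoint_family_on_def)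
        then have "on_lines (tie g l j) (gam i l k) = on_lines {} (gam i l k)"
          using on_lines_gam[OF l k, of i] on_lines_on_lines[of "tie g l j" "tie g l k" "gam i l k"] by simp
        then show ?thesis
          using False by (simp add: on_lines_def zero_vec_def)
      qed (simp add: on_lines_gam l j)
      then show ?thesis
        using j by (simp add: multiplier_def linear_sum[OF linear_on_lines] finite_neighbors)
    qed
    ultimately show "convergent (\<lambda>i. gam i l j)"
      by (auto intro: convergentI)
  qed
qed

end
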